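(* Let $\widetilde x:[0,T]\to\mathbb{R}^2$, $\widetilde x(0)=\widetilde x(T)$, be a Jordan curve bounding the set $U\subset\mathbb{R}^2$. Let $F:\mathbb{R}^2\to\mathbb{R}^2$ be a continuous vector field such that $F(\xi)\neq0$ for each $\xi\in\partial U$. Suppose there exists a (guiding) function $z:[0,T]\to\mathbb{R}^2$, $z(0)=z(T)$, such that: 1) $\langle z(\theta),\dot{\widetilde x}(\theta)\rangle\neq0$ for each $\theta\in[0,T]$; 2) the scalar function $\theta\mapsto\langle F(\widetilde x(\theta)),z(\theta)\rangle$ has exactly two zeros $\theta_1,\theta_2$ on the interval $[0,T)$ and is strictly monotone at these points; 3) $\displaystyle\operatorname{sign}\left\langle F(\widetilde x(\theta_1)),\begin{pmatrix}z_2(\theta_1)\\-z_1(\theta_1)\end{pmatrix}\right\rangle=-\operatorname{sign}\left\langle F(\widetilde x(\theta_2)),\begin{pmatrix}z_2(\theta_2)\\-z_1(\theta_2)\end{pmatrix}\right\rangle.$ Then either $d(F,U)=0$ or $d(F,U)=2$.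
   Context: Here $T>0$, $\langle\cdot,\cdot\rangle$ is the usual scalar product in $\mathbb{R}^2$, $z=(z_1,z_2)$, the dot denotes the derivative with respect to the parameter of the curve, and $d(F,U)=d_{\mathbb{R}^2}(F,U)$ is the topological (Brouwer) degree of the vector field $F$ on the open set $U$ (with respect to $0$). $U$ is the interior of the Jordan curve, so that $\partial U=\widetilde x([0,T])$.
   Formalization: The guiding function z is assumed continuous on [0,T] (for arbitrary z the claim fails, e.g. for ζ³ on the unit circle), and the Jordan curve x̃ is assumed continuously differentiable on [0,T], one-sidedly at the endpoints. *)

theory Defs
  imports "HOL-Analysis.Analysis"
begin

text \<open>
  The Brouwer degree \<open>d(F, U)\<close> with respect to \<open>0\<close>, for \<open>U\<close> bounded and open and \<open>F\<close> continuous on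
  \<open>closure U\<close> without zeros on \<open>frontier U\<close>, is introduced in the usual analytic way: as the sum of the
  signs of the Jacobian determinants at the zeros of a smooth map for which \<open>0\<close> is a regular value
  and which is uniformly closer to \<open>F\<close> than the distance of \<open>F ` frontier U\<close> from \<open>0\<close>.
\<close>

definition regular_C1_map :: "(real^'n \<Rightarrow> real^'n) \<Rightarrow> (real^'n) set \<Rightarrow> bool" where
  "regular_C1_map g U \<longleftrightarrow>
     continuous_on (closure U) g \<and>
     (\<forall>x\<in>U. g differentiable (at x)) \<and>
     continuous_on U (\<lambda>x. jacobian g (at x)) \<and>
     (\<forall>x\<in>U. g x = 0 \<longrightarrow> det (jacobian g (at x)) \<noteq> 0)"

text \<open>
  Since \<open>closure U\<close> is compact, the pointwise strict bound below is the same as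
  the strict bound on the supremum of \<open>dist (g x) (F x)\<close>.
\<close>

definition regular_approximation ::
    "(real^'n \<Rightarrow> real^'n) \<Rightarrow> (real^'n \<Rightarrow> real^'n) \<Rightarrow> (real^'n) set \<Rightarrow> bool" where
  "regular_approximation g F U \<longleftrightarrow>
     regular_C1_map g U \<and>
     (\<forall>x\<in>closure U. dist (g x) (F x) < infdist 0 (F ` frontier U))"

text \<open>
  The definite description is meaningful because such maps \<open>g\<close> exist (Weierstrass and Sard) and the
  sum does not depend on which of them is taken (homotopy invariance). The zero set of \<open>g\<close> in \<open>U\<close> is
  finite, being compact and discrete. Outside the situation described
  above (\<open>U\<close> bounded and open, \<open>F\<close> continuous, no zeros on the frontier) the value is unspecified.
\<close>

definition brouwer_degree :: "(real^'n \<Rightarrow> real^'n) \<Rightarrow> (real^'n) set \<Rightarrow> int" where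
  "brouwer_degree F U =
     (THE d. \<exists>g. regular_approximation g F U \<and>
        real_of_int d = (\<Sum>x | x \<in> U \<and> g x = 0. sgn (det (jacobian g (at x)))))"

text \<open>
  Strict monotonicity at a single point \<open>t\<close> compares the value at \<open>t\<close> with the values at nearby points
  of the domain \<open>S\<close>; at an endpoint of an interval \<open>S\<close> it is a one-sided condition.
\<close>

definition strictly_increasing_at :: "(real \<Rightarrow> real) \<Rightarrow> real set \<Rightarrow> real \<Rightarrow> bool" where
  "strictly_increasing_at f S t \<longleftrightarrow>
     (\<exists>e>0. \<forall>s\<in>S. \<bar>s - t\<bar> < e \<longrightarrow> (s < t \<longrightarrow> f s < f t) \<and> (t < s \<longrightarrow> f t < f s))"

definition strictly_monotone_at :: "(real \<Rightarrow> real) \<Rightarrow> real set \<Rightarrow> real \<Rightarrow> bool" where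
  "strictly_monotone_at f S t \<longleftrightarrow>
     strictly_increasing_at f S t \<or> strictly_increasing_at (\<lambda>s. - f s) S t"

end

theory Submission
  imports Defs "HOL-Complex_Analysis.Complex_Analysis"
begin

text \<open>
  On the region \<open>U\<close> inside a Jordan curve \<open>\<gamma>\<close> the Brouwer degree of \<open>F\<close> is a winding number:
  \<open>d(F, U) = w(F \<circ> \<gamma>) \<cdot> o\<close>, where \<open>w\<close> is the winding number about the origin and
  \<open>o \<in> {1, -1}\<close>, the winding number of \<open>\<gamma>\<close> about the points of \<open>U\<close>, is its orientation
  (\<open>brouwer_degree_eq_winding_number\<close>). The theorem follows from two computations.

  First, \<open>w(z) = o\<close> (\<open>winding_number_nowhere_normal_field\<close>). By the first hypothesis \<open>z\<close> is never
  normal to \<open>\<gamma>\<close>, so \<open>\<i>z\<close> is never tangent and points to one side of the curve all along. For a suitable small \<open>h\<close> the loop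
  \<open>p = \<gamma> + h\<i>z\<close> therefore runs in \<open>U\<close>, which is simply connected; contracting \<open>p\<close> to a point
  \<open>a\<close> of \<open>U\<close> deforms \<open>h\<i>z = p - \<gamma>\<close> into \<open>a - \<gamma>\<close> without zeros, and this loop has winding number \<open>o\<close>.
  The argument stands in for the theorem on turning tangents and tolerates the corner which \<open>\<gamma>\<close> may have
  where its ends meet.

  Second, the winding numbers of \<open>F \<circ> \<gamma>\<close> and \<open>z\<close> differ by \<open>1\<close> or \<open>-1\<close>. Their difference is the winding
  number of the product \<open>q\<close> of \<open>F \<circ> \<gamma>\<close> with the conjugate of \<open>z\<close>. The real part of \<open>q\<close> is
  \<open>\<langle>F \<circ> \<gamma>, z\<rangle>\<close>, so \<open>q\<close> meets the imaginary axis exactly twice, passing from one half plane to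
  the other and back (\<open>sign_pattern_two_zeros\<close>), and the third hypothesis says that it does so on
  opposite sides of the origin. Hence it goes around the origin exactly once
  (\<open>winding_number_two_imaginary_axis_crossings\<close>). Altogether
  \<open>d(F, U) = (o \<plusminus> 1) \<cdot> o = 1 \<plusminus> 1\<close>.

  The degree formula, and with it the independence of the degree of the regular approximation \<open>g\<close>,
  rests on \<open>argument_principle_regular_zeros\<close>: dividing \<open>g\<close> near each zero \<open>a\<close> by \<open>w - a\<close> or by its
  conjugate, according to the sign of the Jacobian, removes the zeros one by one and changes the
  winding number along \<open>\<gamma>\<close> by \<open>\<plusminus>o\<close>; what remains is a nonvanishing function on the closure of \<open>U\<close>,
  and such a function has a continuous logarithm because the complement of this set is connected.
\<close>

section \<open>Winding numbers about the origin via logarithms\<close>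

lemma winding_number_exp_path:
  assumes "path q" "\<And>t. t \<in> {0..1} \<Longrightarrow> p t = exp (q t)"
  shows "winding_number p 0 = (pathfinish q - pathstart q) / (2 * of_real pi * \<i>)"
proof -
  have "winding_number p 0 = winding_number (exp \<circ> q) 0"
    by (rule winding_number_cong) (use assms in auto)
  then show ?thesis
    using winding_number_compose_exp[OF assms(1)] by simp
qed

lemma winding_number_times:
  assumes "path p" "0 \<notin> path_image p" "path q" "0 \<notin> path_image q"
  shows "winding_number (\<lambda>t. p t * q t) 0 = winding_number p 0 + winding_number q 0"
proof -
  obtain a where a: "path a" "pathfinish a - pathstart a = 2 * of_real pi * \<i> * winding_number p 0"
     "\<And>t. t \<in> {0..1} \<Longrightarrow> p t = 0 + exp (a t)"
    using winding_number_as_continuous_log[OF assms(1,2)] by metis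
  obtain b where b: "path b" "pathfinish b - pathstart b = 2 * of_real pi * \<i> * winding_number q 0"
     "\<And>t. t \<in> {0..1} \<Longrightarrow> q t = 0 + exp (b t)"
    using winding_number_as_continuous_log[OF assms(3,4)] by metis
  have "path (\<lambda>t. a t + b t)"
    using a(1) b(1) unfolding path_def by (intro continuous_intros)
  then have "winding_number (\<lambda>t. p t * q t) 0
      = (pathfinish (\<lambda>t. a t + b t) - pathstart (\<lambda>t. a t + b t)) / (2 * of_real pi * \<i>)"
    by (rule winding_number_exp_path) (simp add: a(3) b(3) exp_add)
  also have "\<dots> = ((pathfinish a - pathstart a) + (pathfinish b - pathstart b)) / (2 * of_real pi * \<i>)"
    by (simp add: pathfinish_def pathstart_def algebra_simps)
  finally show ?thesis
    by (simp add: a(2) b(2) add_divide_distrib)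
qed

lemma winding_number_cnj_loop:
  assumes "path p" "0 \<notin> path_image p" "pathfinish p = pathstart p"
  shows "winding_number (\<lambda>t. cnj (p t)) 0 = - winding_number p 0"
proof -
  obtain a where a: "path a" "pathfinish a - pathstart a = 2 * of_real pi * \<i> * winding_number p 0"
     "\<And>t. t \<in> {0..1} \<Longrightarrow> p t = 0 + exp (a t)"
    using winding_number_as_continuous_log[OF assms(1,2)] by metis
  have "path (\<lambda>t. cnj (a t))"
    using a(1) unfolding path_def by (intro continuous_intros)
  then have "winding_number (\<lambda>t. cnj (p t)) 0
      = (pathfinish (\<lambda>t. cnj (a t)) - pathstart (\<lambda>t. cnj (a t))) / (2 * of_real pi * \<i>)"
    by (rule winding_number_exp_path) (simp add: a(3) exp_cnj)
  also have "\<dots> = cnj (pathfinish a - pathstart a) / (2 * of_real pi * \<i>)"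
    by (simp add: pathfinish_def pathstart_def)
  also have "\<dots> = - cnj (winding_number p 0)"
    by (simp add: a(2) field_simps)
  also have "cnj (winding_number p 0) = winding_number p 0"
    using integer_winding_number[OF assms(1,3,2)] by (metis Ints_cases complex_cnj_of_int)
  finally show ?thesis .
qed

lemma winding_number_const_times:
  assumes "path p" "0 \<notin> path_image p" "k \<noteq> 0"
  shows "winding_number (\<lambda>t. k * p t) 0 = winding_number p 0"
  using winding_number_times[of "\<lambda>t. k" p] assms
  by (auto simp: path_image_def path_def winding_number_zero_const)


section \<open>Counting regular zeros with a winding number\<close>

text \<open>
  The two linear models of a zero: a regular zero of a planar map looks like \<open>w\<close> or like the conjugate of
  \<open>w\<close>, up to homotopy, according to the sign \<open>s\<close> of its Jacobian determinant.
\<close>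

definition conj_if_neg :: "real \<Rightarrow> complex \<Rightarrow> complex" where
  "conj_if_neg s w = (if 0 < s then w else cnj w)"

text \<open>
  Differentiability is weakened to closeness to a multiple of the linear model. The resulting
  bound keeps the quotient by the linear model away from the origin, which is what removing the zero takes.
\<close>

definition regular_zero :: "(complex \<Rightarrow> complex) \<Rightarrow> real \<Rightarrow> complex \<Rightarrow> bool" where
  "regular_zero g s a \<longleftrightarrow> (\<exists>\<alpha> c r. 0 < r \<and> c < norm \<alpha> \<and>
     (\<forall>z\<in>ball a r. norm (g z - \<alpha> * conj_if_neg s (z - a)) \<le> c * norm (z - a)))"

lemma norm_conj_if_neg [simp]: "norm (conj_if_neg s w) = norm w"
  by (simp add: conj_if_neg_def)

lemma conj_if_neg_eq_0 [simp]: "conj_if_neg s w = 0 \<longleftrightarrow> w = 0"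
  by (simp add: conj_if_neg_def)

lemma continuous_on_conj_if_neg [continuous_intros]:
  "continuous_on A f \<Longrightarrow> continuous_on A (\<lambda>x. conj_if_neg s (f x))"
  by (cases "0 < s") (auto simp: conj_if_neg_def intro!: continuous_intros)

text \<open>
  When one zero is removed by division, this keeps the other zeros regular with the same sign.
\<close>

lemma regular_zero_mult:
  assumes g: "regular_zero g s b" and \<phi>: "isCont \<phi> b" "\<phi> b \<noteq> 0"
    and h: "\<forall>\<^sub>F z in nhds b. h z = g z * \<phi> z"
  shows "regular_zero h s b"
proof -
  obtain \<alpha> c r where r: "0 < r" "c < norm \<alpha>"
    and gr: "\<And>z. z \<in> ball b r \<Longrightarrow> norm (g z - \<alpha> * conj_if_neg s (z - b)) \<le> c * norm (z - b)"
    using g unfolding regular_zero_def by blast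
  define c' where "c' = max c 0"
  \<comment> \<open>With \<open>\<epsilon>\<close> bounding the oscillation of \<open>\<phi>\<close>, the new error constant still lies below the new leading coefficient.\<close>
  define \<epsilon> where "\<epsilon> = (norm \<alpha> - c') * norm (\<phi> b) / (2 * (norm \<alpha> + c' + 1))"
  have c': "0 \<le> c'" "c \<le> c'" "c' < norm \<alpha> \<or> norm \<alpha> = 0" "c < norm \<alpha>"
    using r(2) by (auto simp: c'_def)
  have gr': "norm (g z - \<alpha> * conj_if_neg s (z - b)) \<le> c' * norm (z - b)" if "z \<in> ball b r" for z
    using gr[OF that] c'(2) mult_right_mono[OF c'(2), of "norm (z - b)"] by simp
  have al: "\<alpha> \<noteq> 0"
  proof
    assume "\<alpha> = 0"
    then have "c < 0" using r by simp
    moreover have "b + of_real (r/2) \<in> ball b r" using r by (simp add: dist_norm)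
    ultimately have "0 \<le> c * norm (b + of_real (r/2) - b)"
      using gr[of "b + of_real (r/2)"] norm_ge_zero order_trans by blast
    then show False
      using \<open>c < 0\<close> r by (simp add: zero_le_mult_iff)
  qed
  then have c'\<alpha>: "c' < norm \<alpha>" using c' by auto
  have \<epsilon>: "0 < \<epsilon>"
    unfolding \<epsilon>_def using c'\<alpha> \<phi>(2) c'(1) by (intro divide_pos_pos mult_pos_pos) auto
  have "\<forall>\<^sub>F z in nhds b. dist (\<phi> z) (\<phi> b) < \<epsilon>"
    using \<phi>(1) \<epsilon> by (metis isCont_def tendsto_at_iff_tendsto_nhds tendstoD)
  then have "\<forall>\<^sub>F z in nhds b. dist (\<phi> z) (\<phi> b) < \<epsilon> \<and> h z = g z * \<phi> z"
    using h by (rule eventually_conj)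
  then obtain d where d: "0 < d" "\<And>z. dist z b < d \<Longrightarrow> dist (\<phi> z) (\<phi> b) < \<epsilon> \<and> h z = g z * \<phi> z"
    unfolding eventually_nhds_metric by blast
  have eq: "\<epsilon> * (norm \<alpha> + c') < (norm \<alpha> - c') * norm (\<phi> b)"
  proof -
    have "\<epsilon> * (norm \<alpha> + c' + 1) = (norm \<alpha> - c') * norm (\<phi> b) / 2"
    proof -
      have "norm \<alpha> + c' + 1 \<noteq> 0" using c'(1) by (smt (verit) norm_ge_zero)
      then show ?thesis unfolding \<epsilon>_def by (simp add: field_simps)
    qed
    moreover have "\<epsilon> * (norm \<alpha> + c') < \<epsilon> * (norm \<alpha> + c' + 1)" using \<epsilon> by simp
    moreover have "0 < (norm \<alpha> - c') * norm (\<phi> b)" using c'\<alpha> \<phi>(2) by simp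
    ultimately show ?thesis by linarith
  qed
  show ?thesis
    unfolding regular_zero_def
  proof (intro exI conjI ballI)
    show "0 < min r d" using r d by simp
    show "\<epsilon> * norm \<alpha> + (norm (\<phi> b) + \<epsilon>) * c' < norm (\<alpha> * \<phi> b)"
      using eq by (simp add: norm_mult algebra_simps)
    fix z assume z: "z \<in> ball b (min r d)"
    then have dz: "norm (\<phi> z - \<phi> b) < \<epsilon>" "h z = g z * \<phi> z"
      using d(2)[of z] by (auto simp: dist_norm norm_minus_commute)
    have n\<phi>: "norm (\<phi> z) \<le> norm (\<phi> b) + \<epsilon>"
      using dz(1) norm_triangle_ineq2[of "\<phi> z" "\<phi> b"] by linarith
    let ?w = "conj_if_neg s (z - b)"
    have "h z - \<alpha> * \<phi> b * ?w = \<alpha> * (\<phi> z - \<phi> b) * ?w + \<phi> z * (g z - \<alpha> * ?w)"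
      using dz(2) by (simp add: algebra_simps)
    then have "norm (h z - \<alpha> * \<phi> b * ?w) \<le> norm (\<alpha> * (\<phi> z - \<phi> b) * ?w) + norm (\<phi> z * (g z - \<alpha> * ?w))"
      by (metis norm_triangle_ineq)
    also have "\<dots> = norm \<alpha> * norm (\<phi> z - \<phi> b) * norm (z - b) + norm (\<phi> z) * norm (g z - \<alpha> * ?w)"
      by (simp add: norm_mult)
    also have "\<dots> \<le> norm \<alpha> * \<epsilon> * norm (z - b) + (norm (\<phi> b) + \<epsilon>) * (c' * norm (z - b))"
      using dz n\<phi> gr'[of z] z \<epsilon> by (intro add_mono mult_mono) (auto intro: mult_nonneg_nonneg)
    finally show "norm (h z - \<alpha> * \<phi> b * ?w) \<le> (\<epsilon> * norm \<alpha> + (norm (\<phi> b) + \<epsilon>) * c') * norm (z - b)"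
      by (simp add: algebra_simps)
  qed
qed

text \<open>
  Near \<open>a\<close> the quotient of \<open>g\<close> by the linear model lies in a disc around \<open>\<alpha>\<close> that omits the origin.
  Pulling it towards the centre \<open>\<alpha>\<close> as \<open>a\<close> is approached makes it continuous at \<open>a\<close>
  and does not create zeros.
\<close>

lemma remove_regular_zero:
  assumes g: "continuous_on S g" and reg: "regular_zero g s a" and "0 < \<epsilon>"
  obtains h e where "0 < e" "e < \<epsilon>" "continuous_on S h" "\<And>z. z \<in> ball a e \<Longrightarrow> h z \<noteq> 0"
    "\<And>z. e \<le> dist a z \<Longrightarrow> h z = g z / conj_if_neg s (z - a)"
proof -
  obtain \<alpha> c r where r: "0 < r" "c < norm \<alpha>"
    and gr: "\<And>z. z \<in> ball a r \<Longrightarrow> norm (g z - \<alpha> * conj_if_neg s (z - a)) \<le> c * norm (z - a)"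
    using reg unfolding regular_zero_def by blast
  define e where "e = min r \<epsilon> / 2"
  have e: "0 < e" "e < \<epsilon>" "e < r" using r \<open>0 < \<epsilon>\<close> by (auto simp: e_def)
  define q where "q = (\<lambda>z. g z / conj_if_neg s (z - a) - \<alpha>)"
  \<comment> \<open>The cut-off vanishes at \<open>a\<close>, which makes the junk value of the quotient at \<open>a\<close> harmless.\<close>
  define \<kappa> where "\<kappa> = (\<lambda>z. min 1 (norm (z - a) / e))"
  define h where "h = (\<lambda>z. \<alpha> + of_real (\<kappa> z) * q z)"
  have q: "norm (q z) \<le> c" if "z \<in> ball a r" "z \<noteq> a" for z
  proof -
    have "q z = (g z - \<alpha> * conj_if_neg s (z - a)) / conj_if_neg s (z - a)"
      using that by (simp add: q_def field_simps)
    then have "norm (q z) = norm (g z - \<alpha> * conj_if_neg s (z - a)) / norm (z - a)"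
      by (simp add: norm_divide)
    then show ?thesis
      using gr[OF that(1)] that(2) by (simp add: divide_le_eq)
  qed
  have \<kappa>: "0 \<le> \<kappa> z" "\<kappa> z \<le> 1" "\<kappa> a = 0" for z
    using e by (auto simp: \<kappa>_def)
  have bound: "norm (h z - \<alpha>) \<le> \<kappa> z * max c 0" if "z \<in> ball a r" for z
  proof (cases "z = a")
    case False
    have "norm (h z - \<alpha>) = \<kappa> z * norm (q z)"
      using \<kappa> by (simp add: h_def norm_mult)
    also have "\<dots> \<le> \<kappa> z * max c 0"
      using q[OF that False] \<kappa> by (intro mult_left_mono) auto
    finally show ?thesis .
  qed (simp add: h_def \<kappa>(3))
  have "\<alpha> \<noteq> 0"
  proof
    assume "\<alpha> = 0"
    then have "c < 0" using r by simp
    moreover have "norm (q (a + of_real (r/2))) \<le> c" 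
      using r by (intro q) (auto simp: dist_norm)
    ultimately show False by (smt (verit) norm_ge_zero)
  qed
  show thesis
  proof
    show "0 < e" "e < \<epsilon>" by fact+
    show "h z \<noteq> 0" if "z \<in> ball a e" for z
    proof
      assume "h z = 0"
      then have "norm \<alpha> \<le> \<kappa> z * max c 0" using bound[of z] that e by simp
      also have "\<dots> \<le> max c 0" using \<kappa> by (simp add: mult_left_le_one_le)
      finally show False using r \<open>\<alpha> \<noteq> 0\<close> by (simp add: max_def split: if_splits)
    qed
    show "h z = g z / conj_if_neg s (z - a)" if "e \<le> dist a z" for z
    proof -
      have "\<kappa> z = 1" using that e by (simp add: \<kappa>_def dist_norm norm_minus_commute)
      then show ?thesis by (simp add: h_def q_def)
    qed
    have h1: "continuous_on (S - {a}) h"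
      unfolding h_def q_def \<kappa>_def using e
      by (auto intro!: continuous_intros continuous_on_subset[OF g])
    have \<kappa>0: "(\<kappa> \<longlongrightarrow> 0) (at a)"
    proof -
      have "isCont \<kappa> a" using e unfolding \<kappa>_def by (intro continuous_intros) auto
      then show ?thesis using \<kappa>(3) by (simp add: isCont_def)
    qed
    have "((\<lambda>z. h z - \<alpha>) \<longlongrightarrow> 0) (at a)"
    proof (rule Lim_null_comparison)
      have "\<forall>\<^sub>F z in at a. z \<in> ball a r" 
        using r by (intro eventually_at_in_open') auto
      then show "\<forall>\<^sub>F z in at a. norm (h z - \<alpha>) \<le> \<kappa> z * max c 0"
        by eventually_elim (rule bound)
      show "((\<lambda>z. \<kappa> z * max c 0) \<longlongrightarrow> 0) (at a)"
        using tendsto_mult_left_zero[OF \<kappa>0] by simp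
    qed
    moreover have "h a = \<alpha>" by (simp add: h_def \<kappa>)
    ultimately have ha: "isCont h a"
      by (simp add: isCont_def Lim_null[symmetric])
    show "continuous_on S h"
      unfolding continuous_on_eq_continuous_within
    proof
      fix z assume z: "z \<in> S"
      show "continuous (at z within S) h"
      proof (cases "z = a")
        case False
        then have "continuous (at z within (S - {a})) h"
          using h1 z by (simp add: continuous_on_eq_continuous_within)
        moreover have "at z within (S - {a}) = at z within S"
          by (rule at_within_nhd[of _ "- {a}"]) (use False in auto)
        ultimately show ?thesis by (metis continuous_within)
      qed (use ha continuous_at_imp_continuous_at_within in blast)
    qed
  qed
qed

text \<open>
  Induction on the zeros. In the base case \<open>g\<close> has a continuous logarithm on \<open>S\<close> by the theorem of Borsuk
  and Eilenberg on compact sets with connected complement; in the step one zero is divided out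
  and contributes the winding number of \<open>\<gamma> - a\<close> or of its conjugate.
\<close>

theorem argument_principle_regular_zeros:
  assumes S: "compact S" "connected (- S)"
    and \<gamma>: "path \<gamma>" "pathfinish \<gamma> = pathstart \<gamma>" "path_image \<gamma> \<subseteq> S - Z"
    and "finite Z" and g: "continuous_on S g" and Z: "{z \<in> S. g z = 0} = Z" "Z \<subseteq> interior S"
    and reg: "\<And>a. a \<in> Z \<Longrightarrow> regular_zero g (s a) a"
  shows "winding_number (g \<circ> \<gamma>) 0 = (\<Sum>a\<in>Z. (if 0 < s a then 1 else -1) * winding_number \<gamma> a)"
  using \<open>finite Z\<close> \<gamma>(3) g Z reg
proof (induction Z arbitrary: g rule: finite_induct)
  case empty
  have "Borsukian S" using S by (simp add: Borsukian_separation_compact)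
  moreover have "g \<in> S \<rightarrow> - {0}" using empty by auto
  ultimately obtain l where l: "continuous_on S l" "\<And>z. z \<in> S \<Longrightarrow> g z = exp (l z)"
    using empty.prems(2) unfolding Borsukian_continuous_logarithm by blast
  have "path (l \<circ> \<gamma>)"
    using \<gamma>(1) empty(1) l(1) by (intro path_continuous_image) (auto intro: continuous_on_subset)
  then have "winding_number (g \<circ> \<gamma>) 0 = (pathfinish (l \<circ> \<gamma>) - pathstart (l \<circ> \<gamma>)) / (2 * of_real pi * \<i>)"
    using empty(1) l(2) by (intro winding_number_exp_path) (force simp: path_image_def)+
  then have "winding_number (g \<circ> \<gamma>) 0 = 0"
    using \<gamma>(2) by (simp only: pathfinish_compose pathstart_compose) simp
  then show ?case
    by (simp only: sum.empty)
next
  case (insert a Z)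
  let ?p = "\<lambda>z. conj_if_neg (s a) (z - a)"
  have aS: "a \<in> interior S" "a \<notin> path_image \<gamma>" using insert.prems by auto
  obtain \<epsilon>1 where e1: "0 < \<epsilon>1" "\<And>b. b \<in> Z \<Longrightarrow> \<epsilon>1 \<le> dist a b"
    using finite_set_avoid[OF insert.hyps(1), of a] insert.hyps(2) by metis
  obtain \<epsilon>2 where e2: "0 < \<epsilon>2" "ball a \<epsilon>2 \<inter> path_image \<gamma> = {}"
  proof -
    have "open (- path_image \<gamma>)" by (simp add: \<gamma>(1) closed_path_image open_Compl)
    then obtain \<epsilon> where "0 < \<epsilon>" "ball a \<epsilon> \<subseteq> - path_image \<gamma>"
      using aS(2) by (meson ComplI openE)
    then show ?thesis using that[of \<epsilon>] by blast
  qed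
  obtain \<epsilon>3 where e3: "0 < \<epsilon>3" "ball a \<epsilon>3 \<subseteq> S"
    using aS(1) by (meson mem_interior)
  obtain h e where e: "0 < e" "e < Min {\<epsilon>1, \<epsilon>2, \<epsilon>3}" and h: "continuous_on S h"
    "\<And>z. z \<in> ball a e \<Longrightarrow> h z \<noteq> 0" "\<And>z. e \<le> dist a z \<Longrightarrow> h z = g z / ?p z"
    by (rule remove_regular_zero[OF insert.prems(2) insert.prems(5)[of a], of "Min {\<epsilon>1, \<epsilon>2, \<epsilon>3}"])
       (use e1 e2 e3 in auto)
  have zeros: "{z \<in> S. h z = 0} = Z"
  proof -
    have "h z = 0 \<longleftrightarrow> z \<in> Z" if "z \<in> S" for z
    proof (cases "z \<in> ball a e")
      case True
      then show ?thesis using h(2)[OF True] e e1(2)[of z] by auto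
    next
      case False
      then have "z \<noteq> a" "h z = g z / ?p z" using h(3)[of z] e by auto
      then show ?thesis using that insert.prems(3) by auto
    qed
    moreover have "Z \<subseteq> S" using insert.prems(3) by auto
    ultimately show ?thesis by blast
  qed
  have reg_h: "regular_zero h (s b) b" if b: "b \<in> Z" for b
  proof (rule regular_zero_mult)
    show "regular_zero g (s b) b" using insert.prems(5) b by blast
    have ba: "b \<noteq> a" using b insert.hyps by blast
    show "isCont (\<lambda>z. 1 / ?p z) b"
    proof -
      have "continuous_on (- {a}) (\<lambda>z. 1 / ?p z)" by (intro continuous_intros) auto
      then show ?thesis
        using ba continuous_on_eq_continuous_at[of "- {a}"] by auto
    qed
    show "1 / ?p b \<noteq> 0" using ba by simp
    have "b \<in> - cball a e" using e1(2)[OF b] e by auto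
    then have "\<forall>\<^sub>F z in nhds b. z \<in> - cball a e"
      by (intro eventually_nhds_in_open) (auto simp: closed_cball open_Compl)
    then show "\<forall>\<^sub>F z in nhds b. h z = g z * (1 / ?p z)"
      by eventually_elim (use h(3) in auto)
  qed
  have IH: "winding_number (h \<circ> \<gamma>) 0 = (\<Sum>a\<in>Z. (if 0 < s a then 1 else -1) * winding_number \<gamma> a)"
    using insert.prems by (intro insert.IH h(1) zeros reg_h) auto
  have far: "e \<le> dist a (\<gamma> t)" "\<gamma> t \<noteq> a" "\<gamma> t \<in> S" "\<gamma> t \<notin> Z" if "t \<in> {0..1}" for t
  proof -
    have "\<gamma> t \<in> path_image \<gamma>" using that by (auto simp: path_image_def)
    then show "e \<le> dist a (\<gamma> t)" "\<gamma> t \<noteq> a" "\<gamma> t \<in> S" "\<gamma> t \<notin> Z" 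
      using e2(2) e aS insert.prems(1) by force+
  qed
  have ph: "path (h \<circ> \<gamma>)" "0 \<notin> path_image (h \<circ> \<gamma>)"
  proof -
    show "path (h \<circ> \<gamma>)"
      using \<gamma>(1) insert.prems(1) by (intro path_continuous_image continuous_on_subset[OF h(1)]) auto
    show "0 \<notin> path_image (h \<circ> \<gamma>)"
      using far(3,4) zeros unfolding path_image_def by fastforce
  qed
  have pp: "path (\<lambda>t. \<gamma> t - a)" "0 \<notin> path_image (\<lambda>t. \<gamma> t - a)"
    "path (\<lambda>t. ?p (\<gamma> t))" "0 \<notin> path_image (\<lambda>t. ?p (\<gamma> t))"
    using \<gamma>(1) far(2) by (auto simp: path_def path_image_def intro!: continuous_intros)
  have "winding_number (g \<circ> \<gamma>) 0 = winding_number (\<lambda>t. (h \<circ> \<gamma>) t * ?p (\<gamma> t)) 0"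
    by (rule winding_number_cong) (use far(1,2) h(3) in auto)
  also have "\<dots> = winding_number (h \<circ> \<gamma>) 0 + winding_number (\<lambda>t. ?p (\<gamma> t)) 0"
    by (intro winding_number_times ph pp)
  also have "winding_number (\<lambda>t. ?p (\<gamma> t)) 0 = (if 0 < s a then 1 else -1) * winding_number (\<lambda>t. \<gamma> t - a) 0"
    using winding_number_cnj_loop[OF pp(1,2)] \<gamma>(2)
    by (simp add: conj_if_neg_def pathfinish_def pathstart_def)
  also have "winding_number (\<lambda>t. \<gamma> t - a) 0 = winding_number \<gamma> a"
    by (metis winding_number_offset)
  finally show ?case
    using IH insert.hyps by (simp add: o_def)
qed

section \<open>Existence of regular approximations\<close>

lemma real_polynomial_function_C1:
  fixes f :: "'a::euclidean_space \<Rightarrow> real"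
  assumes "real_polynomial_function f"
  shows "\<exists>D. (\<forall>x. (f has_derivative D x) (at x)) \<and> (\<forall>h. continuous_on UNIV (\<lambda>x. D x h))"
  using assms
proof induction
  case (linear f)
  then show ?case
    by (intro exI[of _ "\<lambda>x. f"]) (auto intro: bounded_linear.has_derivative)
next
  case (const c)
  show ?case by (intro exI[of _ "\<lambda>x h. 0"]) auto
next
  case (add f g)
  then obtain D E where "\<And>x. (f has_derivative D x) (at x)" "\<And>h. continuous_on UNIV (\<lambda>x. D x h)"
    "\<And>x. (g has_derivative E x) (at x)" "\<And>h. continuous_on UNIV (\<lambda>x. E x h)"
    by metis
  then show ?case
    by (intro exI[of _ "\<lambda>x h. D x h + E x h"]) (auto intro!: derivative_intros continuous_intros)
next
  case (mult f g)
  then obtain D E where *: "\<And>x. (f has_derivative D x) (at x)" "\<And>h. continuous_on UNIV (\<lambda>x. D x h)"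
    "\<And>x. (g has_derivative E x) (at x)" "\<And>h. continuous_on UNIV (\<lambda>x. E x h)"
    by metis
  have "continuous_on UNIV f" "continuous_on UNIV g"
    using *(1,3) by (auto intro!: continuous_at_imp_continuous_on has_derivative_continuous)
  with * show ?case
    by (intro exI[of _ "\<lambda>x h. f x * E x h + D x h * g x"]) (auto intro!: derivative_intros continuous_intros)
qed

lemma continuous_on_jacobian_polynomial:
  fixes p :: "real^'n \<Rightarrow> real^'m"
  assumes "polynomial_function p"
  shows "continuous_on S (\<lambda>x. jacobian p (at x))"
proof -
  have diff: "(p has_derivative frechet_derivative p (at x)) (at x)" for x
    using differentiable_at_polynomial_function[OF assms] frechet_derivative_works by blast
  have "continuous_on S (\<lambda>x. jacobian p (at x) $ i $ j)" for i j
  proof -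
    have "real_polynomial_function (\<lambda>x. p x $ i)"
      using assms bounded_linear_vec_nth unfolding polynomial_function_def o_def by blast
    then obtain D where D: "\<And>x. ((\<lambda>x. p x $ i) has_derivative D x) (at x)"
      "\<And>h. continuous_on UNIV (\<lambda>x. D x h)"
      using real_polynomial_function_C1 by metis
    have "((\<lambda>x. p x $ i) has_derivative (\<lambda>h. frechet_derivative p (at x) h $ i)) (at x)" for x
      using diff by (rule bounded_linear.has_derivative[OF bounded_linear_vec_nth])
    then have "(\<lambda>h. frechet_derivative p (at x) h $ i) = D x" for x
      using D(1) has_derivative_unique by blast
    then have "jacobian p (at x) $ i $ j = D x (axis j 1)" for x
      by (simp add: jacobian_def matrix_def fun_eq_iff)
    then show ?thesis
      using continuous_on_subset[OF D(2)] by simp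
  qed
  then have "continuous_on S (\<lambda>x. \<chi> i j. jacobian p (at x) $ i $ j)"
    by (intro continuous_on_vec_lambda)
  then show ?thesis
    by (simp add: vec_lambda_eta)
qed

lemma jacobian_diff_const:
  fixes p :: "real^'n \<Rightarrow> real^'m"
  assumes "p differentiable (at x)"
  shows "jacobian (\<lambda>x. p x - y) (at x) = jacobian p (at x)"
proof -
  have "(p has_derivative frechet_derivative p (at x)) (at x)"
    using assms frechet_derivative_works by blast
  then have "((\<lambda>x. p x - y) has_derivative frechet_derivative p (at x)) (at x)"
    using has_derivative_diff[OF _ has_derivative_const] by fastforce
  then show ?thesis
    unfolding jacobian_def using frechet_derivative_at by metis
qed

text \<open>
  A polynomial map close to \<open>F\<close>, shifted by a small regular value, which exists by Sard's theorem.
\<close>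

lemma regular_approximation_exists:
  fixes F :: "real^'n::{finite,wellorder} \<Rightarrow> real^'n::{finite,wellorder}"
  assumes U: "bounded U" "U \<noteq> {}"
    and F: "continuous_on (closure U) F" "\<And>x. x \<in> frontier U \<Longrightarrow> F x \<noteq> 0"
  shows "\<exists>g. regular_approximation g F U"
proof -
  define m where "m = infdist 0 (F ` frontier U)"
  have cpt: "compact (closure U)" "compact (frontier U)"
    using U by (auto simp: compact_closure compact_frontier_bounded)
  have "U \<noteq> UNIV" using U by auto
  then have "frontier U \<noteq> {}" using U(2) frontier_not_empty by blast
  moreover have "compact (F ` frontier U)"
    using cpt(2) by (intro compact_continuous_image continuous_on_subset[OF F(1)])
      (auto simp: frontier_def)
  ultimately have m: "0 < m"
    unfolding m_def using F(2) by (intro infdist_pos_not_in_closed) (auto simp: compact_imp_closed)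
  obtain p where p: "polynomial_function p" "\<And>x. x \<in> closure U \<Longrightarrow> norm (F x - p x) < m/2"
    using Stone_Weierstrass_polynomial_function[OF cpt(1) F(1), of "m/2"] m by auto
  have pd: "p differentiable (at x)" for x
    using differentiable_at_polynomial_function[OF p(1)] .
  define C where "C = {x. det (jacobian p (at x)) = 0}"
  have "negligible (p ` C)"
  proof (rule baby_Sard)
    show "(p has_derivative frechet_derivative p (at x)) (at x within C)" for x
      using pd frechet_derivative_works has_derivative_at_withinI by blast
    show "rank (matrix (frechet_derivative p (at x))) < CARD('n::{finite,wellorder})" if "x \<in> C" for x
      using that unfolding C_def det_eq_0_rank jacobian_def by simp
  qed simp
  moreover have "\<not> negligible (ball (0::real^'n::{finite,wellorder}) (m/2))"
    using m by (simp add: open_not_negligible)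
  ultimately have "\<not> ball 0 (m/2) \<subseteq> p ` C"
    using negligible_subset by metis
  then obtain y where y: "y \<in> ball 0 (m/2)" "y \<notin> p ` C"
    by blast
  define g where "g = (\<lambda>x. p x - y)"
  have jac: "jacobian g (at x) = jacobian p (at x)" for x
    unfolding g_def using pd by (rule jacobian_diff_const)
  have gp: "polynomial_function g"
    unfolding g_def using p(1) by (intro polynomial_function_diff) auto
  have "regular_C1_map g U"
    unfolding regular_C1_map_def
  proof (intro conjI ballI impI)
    show "continuous_on (closure U) g"
      using gp by (rule continuous_on_polymonial_function)
    show "g differentiable (at x)" for x
      using gp by (rule differentiable_at_polynomial_function)
    show "continuous_on U (\<lambda>x. jacobian g (at x))"
      using gp by (rule continuous_on_jacobian_polynomial)
    show "det (jacobian g (at x)) \<noteq> 0" if "g x = 0" for x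
    proof -
      have "p x = y" using that by (simp add: g_def)
      then have "x \<notin> C" using y(2) by blast
      then show ?thesis by (simp add: C_def jac)
    qed
  qed
  moreover have "dist (g x) (F x) < m" if "x \<in> closure U" for x
  proof -
    have "dist (g x) (F x) = norm ((F x - p x) + y)"
      by (simp add: g_def dist_norm norm_minus_commute algebra_simps)
    also have "\<dots> \<le> norm (F x - p x) + norm y"
      by (rule norm_triangle_ineq)
    also have "\<dots> < m" using p(2)[OF that] y(1) by simp
    finally show ?thesis .
  qed
  ultimately show ?thesis
    unfolding regular_approximation_def m_def by blast
qed


section \<open>The plane as \<open>\<real>\<^sup>2\<close> and as the complex numbers\<close>

definition complex_of_vec :: "real^2 \<Rightarrow> complex" where
  "complex_of_vec v = Complex (v$1) (v$2)"

definition vec_of_complex :: "complex \<Rightarrow> real^2" where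
  "vec_of_complex w = vector [Re w, Im w]"

lemma vec_of_complex_inverse [simp]:
  "complex_of_vec (vec_of_complex w) = w" "vec_of_complex (complex_of_vec v) = v"
  by (simp_all add: complex_of_vec_def vec_of_complex_def vec_eq_iff forall_2)

lemma complex_of_vec_linear [simp]:
  "complex_of_vec (v + w) = complex_of_vec v + complex_of_vec w"
  "complex_of_vec (v - w) = complex_of_vec v - complex_of_vec w"
  "complex_of_vec (c *\<^sub>R v) = c *\<^sub>R complex_of_vec v"
  "complex_of_vec 0 = 0"
  by (simp_all add: complex_of_vec_def complex_eq_iff)

lemma norm_complex_of_vec [simp]: "norm (complex_of_vec v) = norm v"
  by (simp add: complex_of_vec_def complex_norm norm_vec_def L2_set_def sum_2)

lemma complex_of_vec_eq_0 [simp]: "complex_of_vec v = 0 \<longleftrightarrow> v = 0"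
  using norm_complex_of_vec by (metis norm_eq_zero)

lemma norm_vec_of_complex [simp]: "norm (vec_of_complex w) = norm w"
  using norm_complex_of_vec[of "vec_of_complex w"] by simp

lemma bounded_linear_complex_of_vec: "bounded_linear complex_of_vec"
  by (intro bounded_linear_intro[where K = 1]) auto

lemma vec_of_complex_linear [simp]:
  "vec_of_complex (v + w) = vec_of_complex v + vec_of_complex w"
  "vec_of_complex (v - w) = vec_of_complex v - vec_of_complex w"
  "vec_of_complex (c *\<^sub>R v) = c *\<^sub>R vec_of_complex v"
  by (simp_all add: vec_of_complex_def vec_eq_iff forall_2)

lemma bounded_linear_vec_of_complex: "bounded_linear vec_of_complex"
  by (intro bounded_linear_intro[where K = 1]) auto

lemmas continuous_on_complex_of_vec [continuous_intros] =
  bounded_linear.continuous_on[OF bounded_linear_complex_of_vec]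
lemmas continuous_on_vec_of_complex [continuous_intros] =
  bounded_linear.continuous_on[OF bounded_linear_vec_of_complex]

lemma Re_times_cnj_complex_of_vec: "Re (complex_of_vec v * cnj (complex_of_vec w)) = v \<bullet> w"
  by (simp add: complex_of_vec_def inner_vec_def sum_2)

text \<open>
  The inside is defined through bounded components of the complement, and linear isomorphisms respect both
  components and boundedness.
\<close>

lemma inside_homeomorphic_image:
  fixes f :: "'a::real_normed_vector \<Rightarrow> 'b::real_normed_vector"
  assumes f: "bounded_linear f" "bounded_linear g" and inv: "\<And>x. g (f x) = x" "\<And>y. f (g y) = y"
  shows "inside (f ` S) = f ` inside S"
proof -
  have sub: "h ` connected_component_set A x \<subseteq> connected_component_set (h ` A) (h x)"
    if h: "bounded_linear h" and "x \<in> A" for A x and h :: "'c::real_normed_vector \<Rightarrow> 'd::real_normed_vector"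
  proof (rule connected_component_maximal)
    show "h x \<in> h ` connected_component_set A x" using that(2) by simp
    show "connected (h ` connected_component_set A x)"
      by (intro connected_continuous_image linear_continuous_on h) simp
    show "h ` connected_component_set A x \<subseteq> h ` A"
      using connected_component_subset by (rule image_mono)
  qed
  have gf: "g ` f ` A = A" for A by (simp add: image_image inv)
  have compl: "- f ` S = f ` (- S)"
    using inv by (metis bij_image_Compl_eq bijI')
  have eq: "connected_component_set (f ` (- S)) (f x) = f ` connected_component_set (- S) x" if "x \<in> - S" for x
  proof
    have "g ` connected_component_set (f ` (- S)) (f x) \<subseteq> connected_component_set (- S) x"
      using sub[OF f(2), of "f x" "f ` (- S)"] that by (simp add: gf inv)
    then have "f ` g ` connected_component_set (f ` (- S)) (f x) \<subseteq> f ` connected_component_set (- S) x"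
      by (rule image_mono)
    then show "connected_component_set (f ` (- S)) (f x) \<subseteq> f ` connected_component_set (- S) x"
      by (simp add: image_image inv)
  qed (rule sub[OF f(1) that])
  have bd: "bounded (f ` A) \<longleftrightarrow> bounded A" for A
    using bounded_linear_image[OF _ f(1), of A] bounded_linear_image[OF _ f(2), of "f ` A"] gf by metis
  have iff: "f x \<in> inside (f ` S) \<longleftrightarrow> x \<in> inside S" for x
  proof (cases "x \<in> S")
    case False
    then have "f x \<notin> f ` S" using inv(1) by (metis imageE)
    with False show ?thesis unfolding inside_def compl by (simp add: eq bd)
  next
    case True
    then show ?thesis by (simp add: inside_def)
  qed
  show ?thesis
  proof (rule set_eqI)
    fix y
    show "y \<in> inside (f ` S) \<longleftrightarrow> y \<in> f ` inside S"
    proof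
      assume "y \<in> inside (f ` S)"
      then show "y \<in> f ` inside S"
        using iff[of "g y"] by (intro image_eqI[of y f "g y"]) (simp_all add: inv)
    qed (use iff in blast)
  qed
qed


section \<open>The Brouwer degree on a Jordan region\<close>

text \<open>
  Every real linear map of the plane is \<open>w \<mapsto> \<alpha> w + \<beta> cnj w\<close>. The sign of the determinant tells which of
  the two terms dominates, hence which linear model the map is close to.
\<close>

lemma matrix_vector_mult_complex:
  fixes J :: "real^2^2"
  shows "\<exists>\<alpha> \<beta>. (\<forall>v. complex_of_vec (J *v v) = \<alpha> * complex_of_vec v + \<beta> * cnj (complex_of_vec v))
    \<and> det J = (norm \<alpha>)\<^sup>2 - (norm \<beta>)\<^sup>2"
proof (intro exI conjI allI)
  define a b c d where abcd: "a = J$1$1" "b = J$1$2" "c = J$2$1" "d = J$2$2"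
  let ?\<alpha> = "Complex ((a + d)/2) ((c - b)/2)" and ?\<beta> = "Complex ((a - d)/2) ((c + b)/2)"
  show "complex_of_vec (J *v v) = ?\<alpha> * complex_of_vec v + ?\<beta> * cnj (complex_of_vec v)" for v
    by (simp add: complex_of_vec_def complex_eq_iff matrix_vector_mult_def sum_2 abcd field_simps)
  show "det J = (norm ?\<alpha>)\<^sup>2 - (norm ?\<beta>)\<^sup>2"
    unfolding cmod_power2 complex.sel det_2 abcd by (simp add: power2_eq_square field_simps)
qed

lemma regular_zero_of_det:
  fixes g :: "real^2 \<Rightarrow> real^2"
  assumes g: "(g has_derivative (\<lambda>h. J *v h)) (at (vec_of_complex a))" and "g (vec_of_complex a) = 0"
    and "det J \<noteq> 0"
  shows "regular_zero (\<lambda>w. complex_of_vec (g (vec_of_complex w))) (det J) a"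
proof -
  obtain \<alpha> \<beta> where J: "\<And>v. complex_of_vec (J *v v) = \<alpha> * complex_of_vec v + \<beta> * cnj (complex_of_vec v)"
    and det: "det J = (norm \<alpha>)\<^sup>2 - (norm \<beta>)\<^sup>2"
    using matrix_vector_mult_complex[of J] by blast
  define A B where AB: "A = (if 0 < det J then \<alpha> else \<beta>)" "B = (if 0 < det J then \<beta> else \<alpha>)"
  have "(norm B)\<^sup>2 < (norm A)\<^sup>2"
  proof (cases "0 < det J")
    case True
    then have "(norm \<beta>)\<^sup>2 < (norm \<alpha>)\<^sup>2" using det by linarith
    with True show ?thesis by (simp only: AB if_True)
  next
    case False
    then have "(norm \<alpha>)\<^sup>2 < (norm \<beta>)\<^sup>2" using det \<open>det J \<noteq> 0\<close> by linarith
    with False show ?thesis by (simp only: AB if_False)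
  qed
  then have lt: "norm B < norm A"
    using power2_less_imp_less norm_ge_zero by blast
  define e where "e = (norm A - norm B) / 2"
  have "0 < e" using lt by (simp add: e_def)
  then obtain d where d: "0 < d" "\<And>y. norm (y - vec_of_complex a) < d \<Longrightarrow>
      norm (g y - g (vec_of_complex a) - J *v (y - vec_of_complex a)) \<le> e * norm (y - vec_of_complex a)"
    using g unfolding has_derivative_at_alt by blast
  show ?thesis
    unfolding regular_zero_def
  proof (intro exI conjI ballI)
    show "0 < d" by fact
    show "norm B + e < norm A" using lt by (simp add: e_def field_simps)
    fix z assume z: "z \<in> ball a d"
    let ?w = "z - a"
    have n: "norm (vec_of_complex z - vec_of_complex a) = norm ?w"
      by (metis norm_vec_of_complex vec_of_complex_linear(2))
    let ?G = "complex_of_vec (g (vec_of_complex z))"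
    have "complex_of_vec (g (vec_of_complex z) - g (vec_of_complex a) - J *v (vec_of_complex z - vec_of_complex a))
        = ?G - (\<alpha> * ?w + \<beta> * cnj ?w)"
      using assms(2) by (simp add: J)
    then have 1: "norm (?G - (\<alpha> * ?w + \<beta> * cnj ?w)) \<le> e * norm ?w"
      using d(2)[of "vec_of_complex z"] z n
      by (metis dist_commute dist_norm mem_ball norm_complex_of_vec)
    have "?G - A * conj_if_neg (det J) ?w
        = (?G - (\<alpha> * ?w + \<beta> * cnj ?w)) + B * cnj (conj_if_neg (det J) ?w)"
      by (simp add: conj_if_neg_def AB)
    also have "norm \<dots> \<le> norm (?G - (\<alpha> * ?w + \<beta> * cnj ?w)) + norm B * norm ?w"
      by (rule order_trans[OF norm_triangle_ineq]) (simp add: norm_mult)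
    also have "\<dots> \<le> (norm B + e) * norm ?w"
      using 1 by (simp add: algebra_simps)
    finally show "norm (?G - A * conj_if_neg (det J) ?w) \<le> (norm B + e) * norm ?w" .
  qed
qed

lemma regular_zero_isolated:
  assumes "regular_zero g s a"
  obtains r where "0 < r" "\<And>z. z \<in> ball a r \<Longrightarrow> g z = 0 \<Longrightarrow> z = a"
proof -
  obtain \<alpha> c r where r: "0 < r" "c < norm \<alpha>"
    and gr: "\<And>z. z \<in> ball a r \<Longrightarrow> norm (g z - \<alpha> * conj_if_neg s (z - a)) \<le> c * norm (z - a)"
    using assms unfolding regular_zero_def by blast
  have "z = a" if "z \<in> ball a r" "g z = 0" for z
    using gr[OF that(1)] that(2) r(2) by (simp add: norm_mult mult_le_cancel_right)
  with r(1) that show thesis by blast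
qed

lemma finite_regular_zeros:
  assumes "compact S" "continuous_on S g" "\<And>a. a \<in> S \<Longrightarrow> g a = 0 \<Longrightarrow> regular_zero g (s a) a"
  shows "finite {z \<in> S. g z = 0}"
proof (rule ccontr)
  let ?Z = "{z \<in> S. g z = 0}"
  assume "infinite ?Z"
  moreover have "compact ?Z"
  proof -
    have "closed ?Z"
      using continuous_closed_preimage_constant[OF assms(2) compact_imp_closed[OF assms(1)], of 0] .
    then show ?thesis
      using compact_Int_closed[OF assms(1)] by (metis (no_types, lifting) Int_absorb1 mem_Collect_eq subsetI)
  qed
  ultimately obtain a where a: "a \<in> ?Z" "a islimpt ?Z"
    unfolding compact_eq_Bolzano_Weierstrass by blast
  obtain r where "0 < r" "\<And>z. z \<in> ball a r \<Longrightarrow> g z = 0 \<Longrightarrow> z = a"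
    using regular_zero_isolated assms(3) a(1) by blast
  with a(2) show False
    unfolding islimpt_approachable by (metis (mono_tags, lifting) dist_commute mem_Collect_eq mem_ball)
qed

lemma Jordan_region_vec_of_complex:
  assumes \<gamma>: "simple_path \<gamma>" "pathfinish \<gamma> = pathstart \<gamma>"
    and U: "U = vec_of_complex ` inside (path_image \<gamma>)"
  shows "closure U = vec_of_complex ` (inside (path_image \<gamma>) \<union> path_image \<gamma>)"
    and "frontier U = vec_of_complex ` path_image \<gamma>"
proof -
  define I where "I = inside (path_image \<gamma>)"
  have J: "open I" "frontier I = path_image \<gamma>" "I \<inter> path_image \<gamma> = {}"
    using Jordan_inside_outside[OF \<gamma>] inside_no_overlap[of "path_image \<gamma>"]
    unfolding I_def by simp_all
  have clI: "closure I = I \<union> path_image \<gamma>"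
    using J(2) closure_Un_frontier[of I] by simp
  have bij: "bij vec_of_complex"
    by (metis bijI' vec_of_complex_inverse)
  have lin: "linear vec_of_complex"
    by (simp add: bounded_linear_vec_of_complex bounded_linear.linear)
  show clU: "closure U = vec_of_complex ` (inside (path_image \<gamma>) \<union> path_image \<gamma>)"
    unfolding U I_def[symmetric] clI[symmetric]
    by (rule closure_injective_linear_image[symmetric]) (use bij lin in \<open>auto simp: bij_def\<close>)
  have "open U"
    unfolding U I_def[symmetric]
    by (rule open_surjective_linear_image) (use bij lin J(1) in \<open>auto simp: bij_def\<close>)
  then show "frontier U = vec_of_complex ` path_image \<gamma>"
    using image_set_diff[of vec_of_complex "I \<union> path_image \<gamma>" I] J(3) bij unfolding frontier_def clU
    by (simp add: interior_open U flip: I_def) (auto simp: bij_def Un_Diff)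
qed

text \<open>
  Along the curve a regular approximation \<open>g\<close> stays closer to \<open>F\<close> than \<open>F\<close> is to the origin, so both
  have the same winding number, and for \<open>g\<close> it is \<open>w(\<gamma>, b)\<close> times the signed number of zeros. As
  \<open>w(\<gamma>, b)\<close> is its own inverse, the signed number of zeros is the same for every \<open>g\<close>.
\<close>

theorem brouwer_degree_eq_winding_number:
  fixes F :: "real^2 \<Rightarrow> real^2"
  assumes \<gamma>: "simple_path \<gamma>" "pathfinish \<gamma> = pathstart \<gamma>"
    and U: "U = vec_of_complex ` inside (path_image \<gamma>)" and b: "b \<in> inside (path_image \<gamma>)"
    and F: "continuous_on (closure U) F" "\<And>x. x \<in> frontier U \<Longrightarrow> F x \<noteq> 0"
  shows "of_int (brouwer_degree F U)
       = winding_number (\<lambda>t. complex_of_vec (F (vec_of_complex (\<gamma> t)))) 0 * winding_number \<gamma> b"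
proof -
  define I where "I = inside (path_image \<gamma>)"
  define S where "S = I \<union> path_image \<gamma>"
  have J: "open I" "bounded I" "I \<noteq> {}" "connected (outside (path_image \<gamma>))" "frontier I = path_image \<gamma>"
      "- S = outside (path_image \<gamma>)" "I \<inter> path_image \<gamma> = {}"
    using Jordan_inside_outside[OF \<gamma>] inside_no_overlap[of "path_image \<gamma>"]
      union_with_inside[of "path_image \<gamma>"]
    unfolding I_def S_def by (simp_all add: Un_commute)
  have clI: "closure I = S"
    using J(5) closure_Un_frontier[of I] by (auto simp: S_def)
  have S: "compact S" "connected (- S)"
    using J clI by (auto simp flip: compact_closure)
  have intS: "I \<subseteq> interior S"
    using J(1) by (simp add: S_def interior_maximal)
  have clU: "closure U = vec_of_complex ` S" and frU: "frontier U = vec_of_complex ` path_image \<gamma>"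
    using Jordan_region_vec_of_complex[OF \<gamma> U] by (simp_all add: S_def I_def)
  define G where "G = (\<lambda>g w. complex_of_vec (g (vec_of_complex w)))"
  have contG: "continuous_on S (G g)" if "continuous_on (closure U) g" for g
    unfolding G_def using clU
    by (intro continuous_intros continuous_on_compose2[OF that]) auto
  have pim: "\<gamma> t \<in> path_image \<gamma>" if "t \<in> {0..1}" for t
    using that by (auto simp: path_image_def)
  have wn: "\<forall>a\<in>I. winding_number \<gamma> a = winding_number \<gamma> b" "(winding_number \<gamma> b)\<^sup>2 = 1"
  proof -
    consider "\<forall>a\<in>I. winding_number \<gamma> a = 1" | "\<forall>a\<in>I. winding_number \<gamma> a = -1"
      unfolding I_def using simple_closed_path_winding_number_inside[OF \<gamma>(1)] by metis
    then show "\<forall>a\<in>I. winding_number \<gamma> a = winding_number \<gamma> b" "(winding_number \<gamma> b)\<^sup>2 = 1"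
      using b unfolding I_def[symmetric] by (cases; simp)+
  qed
  have key: "of_real (\<Sum>x | x \<in> U \<and> g x = 0. sgn (det (jacobian g (at x))))
      = winding_number (G F \<circ> \<gamma>) 0 * winding_number \<gamma> b"
    if g: "regular_approximation g F U" for g
  proof -
    have g: "continuous_on (closure U) g" "\<And>x. x \<in> U \<Longrightarrow> g differentiable (at x)"
      "\<And>x. x \<in> U \<Longrightarrow> g x = 0 \<Longrightarrow> det (jacobian g (at x)) \<noteq> 0"
      "\<And>x. x \<in> closure U \<Longrightarrow> dist (g x) (F x) < infdist 0 (F ` frontier U)"
      using g unfolding regular_approximation_def regular_C1_map_def by auto
    have near: "norm (G g w - G F w) < norm (G F w)" if "w \<in> path_image \<gamma>" for w
    proof -
      let ?x = "vec_of_complex w"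
      have x: "?x \<in> frontier U" "?x \<in> closure U" using that frU clU by (auto simp: S_def)
      have "norm (G g w - G F w) = dist (g ?x) (F ?x)"
        unfolding G_def dist_norm by (metis complex_of_vec_linear(2) norm_complex_of_vec)
      also have "\<dots> < infdist 0 (F ` frontier U)" by (rule g(4)[OF x(2)])
      also have "\<dots> \<le> dist 0 (F ?x)" using x(1) by (intro infdist_le) auto
      finally show ?thesis by (simp add: G_def)
    qed
    define s where "s = (\<lambda>a. det (jacobian g (at (vec_of_complex a))))"
    define Z where "Z = {z \<in> S. G g z = 0}"
    have ZI: "Z \<subseteq> I" using near by (force simp: Z_def S_def)
    have reg: "regular_zero (G g) (s a) a" if "a \<in> Z" for a
    proof -
      have a: "vec_of_complex a \<in> U" "g (vec_of_complex a) = 0"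
        using that ZI by (auto simp: U I_def Z_def G_def)
      show ?thesis
        unfolding G_def s_def using a g(2,3) jacobian_works by (intro regular_zero_of_det) auto
    qed
    have fin: "finite Z"
      unfolding Z_def by (rule finite_regular_zeros[OF S(1) contG[OF g(1)]]) (use reg in \<open>auto simp: Z_def\<close>)
    have "winding_number (G F \<circ> \<gamma>) 0 = winding_number (G g \<circ> \<gamma>) 0"
    proof (rule winding_number_nearby_loops_eq[symmetric])
      show "path (G F \<circ> \<gamma>)" "path (G g \<circ> \<gamma>)"
        using contG[OF F(1)] contG[OF g(1)] \<gamma>(1)
        by (auto intro!: path_continuous_image simp: simple_path_imp_path S_def elim: continuous_on_subset)
      show "pathfinish (G F \<circ> \<gamma>) = pathstart (G F \<circ> \<gamma>)" "pathfinish (G g \<circ> \<gamma>) = pathstart (G g \<circ> \<gamma>)"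
        using \<gamma>(2) by (auto simp: pathfinish_compose pathstart_compose)
      show "norm ((G g \<circ> \<gamma>) t - (G F \<circ> \<gamma>) t) < norm ((G F \<circ> \<gamma>) t - 0)" if "t \<in> {0..1}" for t
        using near[OF pim[OF that]] by simp
    qed
    also have "\<dots> = (\<Sum>a\<in>Z. (if 0 < s a then 1 else -1) * winding_number \<gamma> a)"
    proof (rule argument_principle_regular_zeros[OF S _ \<gamma>(2) _ fin contG[OF g(1)] _ _ reg])
      show "path \<gamma>" using \<gamma>(1) by (rule simple_path_imp_path)
      show "path_image \<gamma> \<subseteq> S - Z" using ZI J(7) by (auto simp: S_def)
      show "{z \<in> S. G g z = 0} = Z" by (simp add: Z_def)
      show "Z \<subseteq> interior S" using ZI intS by blast
    qed
    also have "\<dots> = (\<Sum>a\<in>Z. of_real (sgn (s a)) * winding_number \<gamma> b)"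
    proof (rule sum.cong)
      fix a assume a: "a \<in> Z"
      then have "s a \<noteq> 0"
        using ZI g(3)[of "vec_of_complex a"] by (auto simp: s_def U I_def Z_def G_def)
      then show "(if 0 < s a then 1 else -1) * winding_number \<gamma> a = of_real (sgn (s a)) * winding_number \<gamma> b"
        using wn(1) a ZI by (auto simp: sgn_if)
    qed simp
    also have "\<dots> = of_real (\<Sum>a\<in>Z. sgn (s a)) * winding_number \<gamma> b"
      by (simp add: sum_distrib_right)
    also have "(\<Sum>a\<in>Z. sgn (s a)) = (\<Sum>x | x \<in> U \<and> g x = 0. sgn (det (jacobian g (at x))))"
    proof (rule sum.reindex_cong[of complex_of_vec])
      show "inj_on complex_of_vec {x \<in> U. g x = 0}"
        by (rule inj_on_inverseI[of _ vec_of_complex]) simp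
      show "Z = complex_of_vec ` {x \<in> U. g x = 0}"
      proof -
        have "z \<in> complex_of_vec ` {x \<in> U. g x = 0}" if "z \<in> Z" for z
          using that ZI by (intro image_eqI[of _ _ "vec_of_complex z"]) (auto simp: Z_def U I_def G_def)
        moreover have "complex_of_vec x \<in> Z" if "x \<in> U" "g x = 0" for x
          using that by (auto simp: Z_def U I_def G_def S_def)
        ultimately show ?thesis by blast
      qed
    qed (simp add: s_def)
    finally show ?thesis
      using wn(2) by (simp only: power2_eq_square mult.assoc mult_1_right)
  qed
  have "bounded U" "U \<noteq> {}"
    unfolding U I_def[symmetric] using J(2,3) bounded_linear_vec_of_complex bounded_linear_image by blast+
  then obtain g where g: "regular_approximation g F U"
    using regular_approximation_exists[OF _ _ F] by blast
  let ?w = "winding_number (G F \<circ> \<gamma>) 0 * winding_number \<gamma> b"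
  have "?w \<in> \<int>"
  proof (rule Ints_mult; rule integer_winding_number)
    show "path (G F \<circ> \<gamma>)"
      using contG[OF F(1)] \<gamma>(1)
      by (auto intro!: path_continuous_image simp: simple_path_imp_path S_def elim: continuous_on_subset)
    show "pathfinish (G F \<circ> \<gamma>) = pathstart (G F \<circ> \<gamma>)"
      using \<gamma>(2) by (simp add: pathfinish_compose pathstart_compose)
    show "0 \<notin> path_image (G F \<circ> \<gamma>)"
      using F(2) frU by (auto simp: path_image_def G_def)
    show "path \<gamma>" using \<gamma>(1) by (rule simple_path_imp_path)
    show "b \<notin> path_image \<gamma>" using b J(7) unfolding I_def by blast
  qed fact
  then obtain d where d: "?w = of_int d" by (metis Ints_cases)
  have "(\<Sum>x | x \<in> U \<and> g x = 0. sgn (det (jacobian g (at x)))) = of_int d"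
    if "regular_approximation g F U" for g
  proof -
    have "complex_of_real (\<Sum>x | x \<in> U \<and> g x = 0. sgn (det (jacobian g (at x)))) = of_real (of_int d)"
      unfolding key[OF that] d by simp
    then show ?thesis by (simp only: of_real_eq_iff)
  qed
  then have "brouwer_degree F U = d"
    unfolding brouwer_degree_def using g by (intro the_equality) auto
  then show ?thesis
    using d by (simp add: G_def o_def)
qed

section \<open>Loops crossing the imaginary axis twice\<close>

text \<open>
  On a closed half plane without the origin, bounded by the imaginary axis, the principal logarithm
  of \<open>\<epsilon>q\<close> is continuous, and continuous logarithms of \<open>q\<close> and \<open>\<epsilon>q\<close> differ by a constant on an interval.
\<close>

lemma continuous_log_increment_half_plane:
  fixes c d :: real and L q :: "real \<Rightarrow> complex"
  assumes L: "continuous_on {c..d} L" and q: "\<And>t. t \<in> {c..d} \<Longrightarrow> q t = exp (L t)"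
    and \<epsilon>: "\<epsilon> = 1 \<or> \<epsilon> = (-1::real)" and half: "\<And>t. t \<in> {c..d} \<Longrightarrow> 0 \<le> \<epsilon> * Re (q t)" and "c \<le> d"
  shows "L d - L c = Ln (of_real \<epsilon> * q d) - Ln (of_real \<epsilon> * q c)"
proof -
  define D where "D = (\<lambda>t. L t - Ln (of_real \<epsilon> * q t))"
  have nz: "of_real \<epsilon> * q t \<noteq> 0" if "t \<in> {c..d}" for t
    using q[OF that] \<epsilon> by auto
  have slit: "of_real \<epsilon> * q t \<notin> \<real>\<^sub>\<le>\<^sub>0" if "t \<in> {c..d}" for t
    using nz[OF that] half[OF that] \<epsilon>
    by (auto simp: complex_nonpos_Reals_iff complex_eq_iff)
  have cq: "continuous_on {c..d} q"
    using L by (subst continuous_on_cong[OF refl q]) (auto intro!: continuous_intros)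
  have "continuous_on {c..d} D"
    unfolding D_def using slit L cq by (intro continuous_intros) auto
  moreover have expD: "exp (D t) = of_real \<epsilon>" if "t \<in> {c..d}" for t
    using nz[OF that] q[OF that] \<epsilon> by (auto simp: D_def exp_diff)
  have "\<exists>e>0. \<forall>s. s \<in> {c..d} \<and> D s \<noteq> D t \<longrightarrow> e \<le> norm (D s - D t)" if "t \<in> {c..d}" for t
  proof (intro exI[of _ "2 * pi"] conjI allI impI)
    fix s assume s: "s \<in> {c..d} \<and> D s \<noteq> D t"
    then have "exp (D s) = exp (D t)" using expD that by simp
    then obtain n :: int where n: "D s = D t + (of_int (2 * n) * pi) * \<i>"
      unfolding exp_eq by blast
    then have "n \<noteq> 0" using s by auto
    then have "1 \<le> \<bar>real_of_int n\<bar>" by (metis of_int_1_le_iff of_int_abs zero_less_abs_iff int_one_le_iff_zero_less)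
    moreover have "norm (D s - D t) = 2 * pi * \<bar>real_of_int n\<bar>"
      using n by (simp add: norm_mult)
    ultimately show "2 * pi \<le> norm (D s - D t)"
      using mult_left_mono[of 1 "\<bar>real_of_int n\<bar>" "2 * pi"] by simp
  qed simp
  ultimately have "D constant_on {c..d}"
    by (intro continuous_discrete_range_constant) auto
  then have "D d = D c"
    using \<open>c \<le> d\<close> unfolding constant_on_def by force
  then show ?thesis
    by (simp add: D_def algebra_simps)
qed

text \<open>
  Each of the two half planes contributes half a turn, and the turns have the same sense because the
  crossings are on opposite sides of the origin. The parameter interval is cut at \<open>a\<close> and \<open>b\<close>, so one of the two
  half turns is made up of the pieces before \<open>a\<close> and after \<open>b\<close>.
\<close>

lemma winding_number_two_imaginary_axis_crossings:
  assumes q: "path q" "pathfinish q = pathstart q" "0 \<notin> path_image q"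
    and ab: "0 \<le> a" "a \<le> b" "b \<le> 1" and \<sigma>: "\<sigma> = 1 \<or> \<sigma> = (-1::real)"
    and mid: "\<And>t. t \<in> {a..b} \<Longrightarrow> 0 \<le> \<sigma> * Re (q t)"
    and out: "\<And>t. t \<in> {0..a} \<union> {b..1} \<Longrightarrow> \<sigma> * Re (q t) \<le> 0"
    and signs: "sgn (Im (q a)) = - sgn (Im (q b))"
  shows "winding_number q 0 = 1 \<or> winding_number q 0 = -1"
proof -
  obtain L where L: "path L" "pathfinish L - pathstart L = 2 * of_real pi * \<i> * winding_number q 0"
     "\<And>t. t \<in> {0..1} \<Longrightarrow> q t = 0 + exp (L t)"
    using winding_number_as_continuous_log[OF q(1,3)] by metis
  have cL: "continuous_on {c..d} L" if "0 \<le> c" "d \<le> 1" for c d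
    using L(1) that unfolding path_def by (auto elim: continuous_on_subset)
  have outa: "0 \<le> - \<sigma> * Re (q t)" if "t \<in> {0..a}" for t using out[of t] that by simp
  have outb: "0 \<le> - \<sigma> * Re (q t)" if "t \<in> {b..1}" for t using out[of t] that by simp
  have L3: "q t = exp (L t)" if "0 \<le> t" "t \<le> 1" for t using L(3) that by simp
  let ?s = "of_real \<sigma> :: complex"
  have 1: "L b - L a = Ln (?s * q b) - Ln (?s * q a)"
    by (rule continuous_log_increment_half_plane[OF cL L3 \<sigma> mid]) (use ab in auto)
  have "L a - L 0 = Ln (of_real (-\<sigma>) * q a) - Ln (of_real (-\<sigma>) * q 0)"
    by (rule continuous_log_increment_half_plane[OF cL L3 _ outa]) (use ab \<sigma> in auto)
  then have 2: "L a - L 0 = Ln (- (?s * q a)) - Ln (- (?s * q 0))" by simp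
  have "L 1 - L b = Ln (of_real (-\<sigma>) * q 1) - Ln (of_real (-\<sigma>) * q b)"
    by (rule continuous_log_increment_half_plane[OF cL L3 _ outb]) (use ab \<sigma> in auto)
  then have 3: "L 1 - L b = Ln (- (?s * q 1)) - Ln (- (?s * q b))" by simp
  have q01: "q 1 = q 0" using q(2) by (simp add: pathfinish_def pathstart_def)
  have re: "Re (q t) = 0" "Im (q t) \<noteq> 0" if "t = a \<or> t = b" for t
  proof -
    show r: "Re (q t) = 0" using mid[of t] out[of t] that ab \<sigma> by force
    have "q t \<noteq> 0" using q(3) that ab by (auto simp: path_image_def)
    with r show "Im (q t) \<noteq> 0" by (simp add: complex_eq_iff)
  qed
  have jump: "Ln (?s * q t) - Ln (- (?s * q t)) = of_real (\<sigma> * sgn (Im (q t))) * (\<i> * of_real pi)"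
    if "t = a \<or> t = b" for t
  proof -
    have "?s * q t \<noteq> 0" using re(2)[OF that] \<sigma> by auto
    then show ?thesis
      using re[OF that] \<sigma> by (auto simp: Ln_minus sgn_if)
  qed
  have "2 * of_real pi * \<i> * winding_number q 0 = L 1 - L 0"
    using L(2) by (simp add: pathfinish_def pathstart_def)
  also have "\<dots> = (Ln (?s * q b) - Ln (- (?s * q b))) - (Ln (?s * q a) - Ln (- (?s * q a)))"
  proof -
    have "L 1 - L 0 = (L 1 - L b) + (L b - L a) + (L a - L 0)" by simp
    then show ?thesis unfolding 1 2 3 q01 by (simp add: algebra_simps)
  qed
  also have "\<dots> = 2 * of_real pi * \<i> * of_real (\<sigma> * sgn (Im (q b)))"
    unfolding jump[of a, simplified] jump[of b, simplified] signs by (simp add: algebra_simps)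
  finally have "winding_number q 0 = of_real (\<sigma> * sgn (Im (q b)))"
    by simp
  then show ?thesis
    using \<sigma> re(2)[of b] by (auto simp: sgn_if)
qed

lemma connected_nonvanishing_same_sign:
  fixes f :: "'a::topological_space \<Rightarrow> real"
  assumes "connected J" "continuous_on J f" "\<And>t. t \<in> J \<Longrightarrow> f t \<noteq> 0" "s \<in> J" "t \<in> J"
  shows "0 < f s * f t"
proof -
  have c: "connected (f ` J)" using assms by (intro connected_continuous_image)
  have "0 \<notin> f ` J" using assms(3) by auto
  then have "\<not> (f s \<le> 0 \<and> 0 \<le> f t)" "\<not> (f t \<le> 0 \<and> 0 \<le> f s)"
    using connectedD_interval[OF c, of "f s" "f t" 0] connectedD_interval[OF c, of "f t" "f s" 0] assms(4,5)
    by blast+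
  then show ?thesis by (auto simp: zero_less_mult_iff not_le)
qed

text \<open>
  The function changes sign at \<open>b\<close> by strict monotonicity and at \<open>a\<close> by periodicity. Only \<open>b\<close> is certain to be
  an interior point: if \<open>a = 0\<close>, strict monotonicity at \<open>a\<close> is one-sided.
\<close>

lemma sign_pattern_two_zeros:
  fixes f :: "real \<Rightarrow> real"
  assumes f: "continuous_on {0..T} f" "f 0 = f T" and "a < b"
    and zeros: "{t \<in> {0..<T}. f t = 0} = {a, b}" and mono: "strictly_monotone_at f {0..T} b"
  obtains \<sigma> where "\<sigma> = 1 \<or> \<sigma> = -1" "\<And>t. t \<in> {a..b} \<Longrightarrow> 0 \<le> \<sigma> * f t"
    "\<And>t. t \<in> {0..a} \<union> {b..T} \<Longrightarrow> \<sigma> * f t \<le> 0"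
proof -
  have ab: "0 \<le> a" "b < T" "f a = 0" "f b = 0" using zeros by auto
  have nz: "f t \<noteq> 0" if "0 \<le> t" "t < T" "t \<noteq> a" "t \<noteq> b" for t
    using zeros that by auto
  obtain e where e: "0 < e"
    and "(\<forall>s\<in>{0..T}. \<bar>s - b\<bar> < e \<longrightarrow> (s < b \<longrightarrow> f s < f b) \<and> (b < s \<longrightarrow> f b < f s))
       \<or> (\<forall>s\<in>{0..T}. \<bar>s - b\<bar> < e \<longrightarrow> (s < b \<longrightarrow> - f s < - f b) \<and> (b < s \<longrightarrow> - f b < - f s))"
    using mono unfolding strictly_monotone_at_def strictly_increasing_at_def by blast
  then have mono': "(\<forall>s\<in>{0..T}. \<bar>s - b\<bar> < e \<longrightarrow> (s < b \<longrightarrow> f s < 0) \<and> (b < s \<longrightarrow> 0 < f s))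
       \<or> (\<forall>s\<in>{0..T}. \<bar>s - b\<bar> < e \<longrightarrow> (s < b \<longrightarrow> 0 < f s) \<and> (b < s \<longrightarrow> f s < 0))"
    using ab(4) by simp
  define u v where "u = max ((a + b) / 2) (b - e/2)" and "v = min ((b + T) / 2) (b + e/2)"
  have u: "a < u" "u < b" "\<bar>u - b\<bar> < e" and v: "b < v" "v < T" "\<bar>v - b\<bar> < e"
    using \<open>a < b\<close> ab(2) e unfolding u_def v_def max_def min_def by (auto simp: field_simps)
  have uv: "f u < 0 \<and> 0 < f v \<or> 0 < f u \<and> f v < 0"
    using mono' u v ab by force
  have mid: "0 < f u * f t" if "t \<in> {a<..<b}" for t
    by (rule connected_nonvanishing_same_sign[of "{a<..<b}"])
       (use that u ab nz f(1) in \<open>auto elim: continuous_on_subset\<close>)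
  have right: "0 < f v * f t" if "t \<in> {b<..<T}" for t
    by (rule connected_nonvanishing_same_sign[of "{b<..<T}"])
       (use that v ab nz f(1) \<open>a < b\<close> in \<open>auto elim: continuous_on_subset\<close>)
  have end_left: "0 < f v * f t" if "0 \<le> t" "t < a" for t
  proof -
    have "f T \<noteq> 0" using nz[of 0] f(2) that \<open>a < b\<close> ab by auto
    then have "0 < f v * f T"
    proof (intro connected_nonvanishing_same_sign[of "{b<..T}" f v T])
      show "continuous_on {b<..T} f" using f(1) ab \<open>a < b\<close> by (auto elim: continuous_on_subset)
      show "f t \<noteq> 0" if "t \<in> {b<..T}" for t
        using \<open>f T \<noteq> 0\<close> nz[of t] that ab \<open>a < b\<close> by (cases "t = T") auto
    qed (use v ab in auto)
    moreover have "0 < f 0 * f t"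
      by (rule connected_nonvanishing_same_sign[of "{0..<a}"])
         (use that ab nz f(1) \<open>a < b\<close> in \<open>auto elim: continuous_on_subset\<close>)
    ultimately show ?thesis using f(2) by (auto simp: zero_less_mult_iff)
  qed
  have fT: "0 \<le> f v * f T"
  proof (cases "a = 0")
    case True then show ?thesis using ab f(2) by simp
  next
    case False then show ?thesis using end_left[of 0] ab f(2) by simp
  qed
  show thesis
  proof (rule that[of "sgn (f u)"])
    show "sgn (f u) = 1 \<or> sgn (f u) = -1" using uv by (auto simp: sgn_if)
    show "0 \<le> sgn (f u) * f t" if "t \<in> {a..b}" for t
      using mid[of t] that ab by (cases "t = a \<or> t = b") (auto simp: sgn_if zero_less_mult_iff)
    show "sgn (f u) * f t \<le> 0" if "t \<in> {0..a} \<union> {b..T}" for t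
    proof -
      have "0 \<le> f v * f t"
      proof -
        consider "t = a \<or> t = b" | "0 \<le> t" "t < a" | "b < t" "t < T" | "t = T" using \<open>t \<in> _\<close> by force
        then show ?thesis
          using ab fT end_left[of t] right[of t] by cases auto
      qed
      then show ?thesis using uv by (auto simp: sgn_if zero_le_mult_iff)
    qed
  qed
qed

section \<open>Fields nowhere normal to a Jordan curve\<close>

lemma vector_derivative_inner_increment_pos:
  fixes \<gamma> :: "real \<Rightarrow> complex"
  assumes "\<And>u. u \<in> {0..1} \<Longrightarrow> (\<gamma> has_vector_derivative \<gamma>' u) (at u within {0..1})"
    and "0 \<le> p" "p < q" "q \<le> 1" and pos: "\<And>u. p < u \<Longrightarrow> u < q \<Longrightarrow> 0 < \<gamma>' u \<bullet> w"
  shows "0 < (\<gamma> q - \<gamma> p) \<bullet> w"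
proof -
  have "\<gamma> p \<bullet> w < \<gamma> q \<bullet> w"
  proof (rule DERIV_pos_imp_increasing_open[of p q "\<lambda>u. \<gamma> u \<bullet> w"])
    fix u assume u: "p < u" "u < q"
    then have "(\<gamma> has_vector_derivative \<gamma>' u) (at u)"
      using assms(1)[of u] assms(2,4) at_within_interior[of u "{0..1}"] by simp
    then have "((\<lambda>u. \<gamma> u \<bullet> w) has_real_derivative (\<gamma>' u \<bullet> w)) (at u)"
      unfolding has_real_derivative_iff_has_vector_derivative
      by (rule bounded_linear.has_vector_derivative[OF bounded_linear_inner_left])
    then show "\<exists>y. ((\<lambda>u. \<gamma> u \<bullet> w) has_real_derivative y) (at u) \<and> 0 < y"
      using pos[OF u] by blast
  next
    have "continuous_on {0..1} \<gamma>"
      using assms(1) has_vector_derivative_continuous continuous_on_eq_continuous_within by blast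
    then show "continuous_on {p..q} (\<lambda>u. \<gamma> u \<bullet> w)"
      using assms(2,4) by (intro continuous_intros) (auto elim: continuous_on_subset)
  qed fact
  then show ?thesis by (simp add: inner_diff_left)
qed

lemma compact_positive_lower_bound:
  fixes f :: "'a::topological_space \<Rightarrow> real"
  assumes "compact K" "continuous_on K f" "\<And>x. x \<in> K \<Longrightarrow> 0 < f x"
  obtains m where "0 < m" "\<And>x. x \<in> K \<Longrightarrow> m \<le> f x"
proof (cases "K = {}")
  case True then show thesis using that[of 1] by auto
next
  case False
  then obtain x where "x \<in> K" "\<And>y. y \<in> K \<Longrightarrow> f x \<le> f y"
    using continuous_attains_inf[OF assms(1) _ assms(2)] by blast
  with that[of "f x"] assms(3) show thesis by blast
qed

text \<open>Distance on the parameter circle obtained by gluing the ends of the unit interval.\<close>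

definition cyclic_dist :: "real \<Rightarrow> real \<Rightarrow> real" where
  "cyclic_dist u t = min \<bar>u - t\<bar> (1 - \<bar>u - t\<bar>)"

text \<open>
  By compactness \<open>\<gamma>' u\<close> has a positive inner product with \<open>Z t\<close> whenever \<open>u\<close> and \<open>t\<close> are
  close on the parameter circle, also across the ends, where \<open>\<gamma>'\<close> may jump but \<open>Z\<close> does not. Hence
  \<open>\<gamma>\<close> advances strictly in the direction \<open>Z t\<close> there, and a short chord is not orthogonal to \<open>Z t\<close>.
\<close>

lemma short_chord_not_orthogonal:
  fixes \<gamma> \<gamma>' Z :: "real \<Rightarrow> complex"
  assumes d: "\<And>u. u \<in> {0..1} \<Longrightarrow> (\<gamma> has_vector_derivative \<gamma>' u) (at u within {0..1})"
    and c: "continuous_on {0..1} \<gamma>'" "continuous_on {0..1} Z" and "\<gamma> 1 = \<gamma> 0" "Z 1 = Z 0"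
    and pos: "\<And>t. t \<in> {0..1} \<Longrightarrow> 0 < \<gamma>' t \<bullet> Z t"
  obtains \<delta> where "0 < \<delta>" "\<And>s t. s \<in> {0..1} \<Longrightarrow> t \<in> {0..1} \<Longrightarrow> cyclic_dist s t < \<delta> \<Longrightarrow>
    (\<gamma> s - \<gamma> t) \<bullet> Z t = 0 \<Longrightarrow> \<gamma> s = \<gamma> t"
proof -
  let ?Q = "{0..1} \<times> {0..1} :: (real \<times> real) set"
  define K where "K = ?Q \<inter> (\<lambda>(u,t). \<gamma>' u \<bullet> Z t) -` {..0}"
  have "continuous_on ?Q (\<lambda>(u,t). \<gamma>' u \<bullet> Z t)"
    unfolding case_prod_beta
    by (intro continuous_intros continuous_on_compose2[OF c(1)] continuous_on_compose2[OF c(2)]) auto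
  then have "closed K"
    unfolding K_def by (intro continuous_closed_preimage) (auto intro: closed_Times)
  then have "compact K"
    using compact_Int_closed[of ?Q K] by (simp add: K_def compact_Times Int_absorb1 Int_assoc[symmetric])
  moreover have "continuous_on K (\<lambda>(u,t). cyclic_dist u t)"
    unfolding cyclic_dist_def case_prod_beta by (intro continuous_intros)
  moreover have "0 < (\<lambda>(u,t). cyclic_dist u t) x" if xK: "x \<in> K" for x
  proof -
    obtain u t where x: "x = (u, t)" "u \<in> {0..1}" "t \<in> {0..1}" "\<gamma>' u \<bullet> Z t \<le> 0"
      using xK unfolding K_def by (cases x) auto
    have "u \<noteq> t" using x(2,4) pos[of u] by auto
    moreover have "\<bar>u - t\<bar> \<noteq> 1"
    proof
      assume "\<bar>u - t\<bar> = 1"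
      then have "u = 0 \<and> t = 1 \<or> u = 1 \<and> t = 0" using x(2,3) by auto
      then show False using x(4) pos[of 0] pos[of 1] \<open>Z 1 = Z 0\<close> by auto
    qed
    ultimately show ?thesis using x(1,2,3) by (auto simp: cyclic_dist_def)
  qed
  ultimately obtain \<delta> where \<delta>: "0 < \<delta>" "\<And>x. x \<in> K \<Longrightarrow> \<delta> \<le> (\<lambda>(u,t). cyclic_dist u t) x"
    using compact_positive_lower_bound by metis
  have close: "0 < \<gamma>' u \<bullet> Z t" if "u \<in> {0..1}" "t \<in> {0..1}" "cyclic_dist u t < \<delta>" for u t
    using \<delta>(2)[of "(u,t)"] that by (force simp: K_def)
  have inc: "0 < (\<gamma> q - \<gamma> p) \<bullet> Z t"
    if "0 \<le> p" "p < q" "q \<le> 1" "t \<in> {0..1}" "\<And>u. p < u \<Longrightarrow> u < q \<Longrightarrow> cyclic_dist u t < \<delta>" for p q t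
    by (rule vector_derivative_inner_increment_pos[OF d]) (use that close in auto)
  have inc0: "0 \<le> (\<gamma> q - \<gamma> p) \<bullet> Z t"
    if "0 \<le> p" "p \<le> q" "q \<le> 1" "t \<in> {0..1}" "\<And>u. p < u \<Longrightarrow> u < q \<Longrightarrow> cyclic_dist u t < \<delta>" for p q t
    using inc[of p q t] that by (cases "p = q") (auto simp: less_le)
  show thesis
  proof (rule that[OF \<delta>(1)])
    fix s t :: real
    assume st: "s \<in> {0..1}" "t \<in> {0..1}" "cyclic_dist s t < \<delta>" and z: "(\<gamma> s - \<gamma> t) \<bullet> Z t = 0"
    show "\<gamma> s = \<gamma> t"
    proof (cases "\<bar>s - t\<bar> < \<delta>")
      case True
      consider "s < t" | "s = t" | "t < s" by linarith
      then show ?thesis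
      proof cases
        case 1
        have "0 < (\<gamma> t - \<gamma> s) \<bullet> Z t"
          by (rule inc) (use 1 st True in \<open>auto simp: cyclic_dist_def\<close>)
        with z show ?thesis by (simp add: inner_diff_left)
      next
        case 3
        have "0 < (\<gamma> s - \<gamma> t) \<bullet> Z t"
          by (rule inc) (use 3 st True in \<open>auto simp: cyclic_dist_def\<close>)
        with z show ?thesis by simp
      qed simp
    next
      case False
      then have far: "1 - \<bar>s - t\<bar> < \<delta>" using st(3) by (auto simp: cyclic_dist_def)
      show ?thesis
      proof (cases "s < t")
        case True
        have "0 \<le> (\<gamma> s - \<gamma> 0) \<bullet> Z t" "s \<noteq> 0 \<Longrightarrow> 0 < (\<gamma> s - \<gamma> 0) \<bullet> Z t"
          by (rule inc0 inc; use True st far in \<open>auto simp: cyclic_dist_def\<close>)+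
        moreover have "0 \<le> (\<gamma> 1 - \<gamma> t) \<bullet> Z t" "t \<noteq> 1 \<Longrightarrow> 0 < (\<gamma> 1 - \<gamma> t) \<bullet> Z t"
          by (rule inc0 inc; use True st far in \<open>auto simp: cyclic_dist_def\<close>)+
        moreover have "(\<gamma> s - \<gamma> 0) \<bullet> Z t + (\<gamma> 1 - \<gamma> t) \<bullet> Z t = 0"
          using z \<open>\<gamma> 1 = \<gamma> 0\<close> by (simp add: inner_diff_left)
        ultimately have "s = 0" "t = 1" by linarith+
        then show ?thesis using \<open>\<gamma> 1 = \<gamma> 0\<close> by simp
      next
        case False
        have "0 \<le> (\<gamma> t - \<gamma> 0) \<bullet> Z t" "t \<noteq> 0 \<Longrightarrow> 0 < (\<gamma> t - \<gamma> 0) \<bullet> Z t"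
          by (rule inc0 inc; use False st far in \<open>auto simp: cyclic_dist_def\<close>)+
        moreover have "0 \<le> (\<gamma> 1 - \<gamma> s) \<bullet> Z t" "s \<noteq> 1 \<Longrightarrow> 0 < (\<gamma> 1 - \<gamma> s) \<bullet> Z t"
          by (rule inc0 inc; use False st far in \<open>auto simp: cyclic_dist_def\<close>)+
        moreover have "(\<gamma> t - \<gamma> 0) \<bullet> Z t + (\<gamma> 1 - \<gamma> s) \<bullet> Z t = 0"
          using z \<open>\<gamma> 1 = \<gamma> 0\<close> by (simp add: inner_diff_left)
        ultimately have "t = 0" "s = 1" by linarith+
        then show ?thesis using \<open>\<gamma> 1 = \<gamma> 0\<close> by simp
      qed
    qed
  qed
qed

text \<open>
  If \<open>\<gamma> t + h\<i>Z t = \<gamma> s\<close>, then the chord from \<open>\<gamma> t\<close> to \<open>\<gamma> s\<close> is orthogonal to \<open>Z t\<close>. For nearby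
  parameters this is excluded by the previous lemma, for distant ones because the chord is too long.
\<close>

lemma push_off_avoids_curve:
  fixes \<gamma> \<gamma>' Z :: "real \<Rightarrow> complex"
  assumes simple: "simple_path \<gamma>" "pathfinish \<gamma> = pathstart \<gamma>"
    and d: "\<And>u. u \<in> {0..1} \<Longrightarrow> (\<gamma> has_vector_derivative \<gamma>' u) (at u within {0..1})"
    and c: "continuous_on {0..1} \<gamma>'" "continuous_on {0..1} Z" and "Z 1 = Z 0"
    and pos: "\<And>t. t \<in> {0..1} \<Longrightarrow> 0 < \<gamma>' t \<bullet> Z t"
  obtains \<epsilon> where "0 < \<epsilon>" "\<And>t h. t \<in> {0..1} \<Longrightarrow> h \<noteq> 0 \<Longrightarrow> \<bar>h\<bar> < \<epsilon> \<Longrightarrow>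
      \<gamma> t + of_real h * (\<i> * Z t) \<notin> path_image \<gamma>"
proof -
  have \<gamma>01: "\<gamma> 1 = \<gamma> 0" using simple(2) by (simp add: pathfinish_def pathstart_def)
  obtain \<delta> where \<delta>: "0 < \<delta>" "\<And>s t. s \<in> {0..1} \<Longrightarrow> t \<in> {0..1} \<Longrightarrow> cyclic_dist s t < \<delta> \<Longrightarrow>
    (\<gamma> s - \<gamma> t) \<bullet> Z t = 0 \<Longrightarrow> \<gamma> s = \<gamma> t"
    using short_chord_not_orthogonal[OF d c \<gamma>01 \<open>Z 1 = Z 0\<close> pos] by metis
  let ?Q = "{0..1} \<times> {0..1} :: (real \<times> real) set"
  define K where "K = ?Q \<inter> (\<lambda>(u,t). cyclic_dist u t) -` {\<delta>..}"
  have "continuous_on ?Q (\<lambda>(u,t). cyclic_dist u t)"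
    unfolding cyclic_dist_def case_prod_beta by (intro continuous_intros)
  then have "closed K"
    unfolding K_def by (intro continuous_closed_preimage) (auto intro: closed_Times)
  then have "compact K"
    using compact_Int_closed[of ?Q K] by (simp add: K_def compact_Times Int_absorb1 Int_assoc[symmetric])
  moreover have "continuous_on K (\<lambda>(s,t). norm (\<gamma> s - \<gamma> t))"
  proof -
    have "continuous_on {0..1} \<gamma>" using simple(1) by (simp add: simple_path_def path_def)
    then show ?thesis
      unfolding case_prod_beta
      by (intro continuous_intros; rule continuous_on_compose2) (auto simp: K_def intro!: continuous_intros)
  qed
  moreover have "0 < (\<lambda>(s,t). norm (\<gamma> s - \<gamma> t)) x" if xK: "x \<in> K" for x
  proof -
    obtain s t where x: "x = (s, t)" "s \<in> {0..1}" "t \<in> {0..1}" "\<delta> \<le> cyclic_dist s t"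
      using xK unfolding K_def by (cases x) auto
    have "s \<noteq> t" "\<not> (s = 0 \<and> t = 1)" "\<not> (s = 1 \<and> t = 0)"
      using x(4) \<delta>(1) by (auto simp: cyclic_dist_def)
    then have "\<gamma> s \<noteq> \<gamma> t"
      using simple(1) x(2,3) unfolding simple_path_def loop_free_def by blast
    then show ?thesis using x(1) by simp
  qed
  ultimately obtain m where m: "0 < m" "\<And>x. x \<in> K \<Longrightarrow> m \<le> (\<lambda>(s,t). norm (\<gamma> s - \<gamma> t)) x"
    using compact_positive_lower_bound by metis
  have "bounded (Z ` {0..1})"
    using c(2) by (intro compact_imp_bounded compact_continuous_image) auto
  then obtain B where B: "0 < B" "\<And>t. t \<in> {0..1} \<Longrightarrow> norm (Z t) \<le> B"
    unfolding bounded_pos by auto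
  show thesis
  proof (rule that[of "m / B"])
    show "0 < m / B" using m B by simp
    fix t h :: real assume t: "t \<in> {0..1}" and h: "h \<noteq> 0" "\<bar>h\<bar> < m / B"
    show "\<gamma> t + of_real h * (\<i> * Z t) \<notin> path_image \<gamma>"
    proof
      assume "\<gamma> t + of_real h * (\<i> * Z t) \<in> path_image \<gamma>"
      then obtain s where s: "s \<in> {0..1}" "\<gamma> s - \<gamma> t = of_real h * (\<i> * Z t)"
        unfolding path_image_def by (metis add_diff_cancel_left' imageE)
      have "Z t \<noteq> 0" using pos[OF t] by auto
      then have ne: "\<gamma> s \<noteq> \<gamma> t" using s(2) h(1) by auto
      have "(\<gamma> s - \<gamma> t) \<bullet> Z t = 0"
        unfolding s(2) by (simp add: inner_complex_def algebra_simps)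
      then have "\<delta> \<le> cyclic_dist s t" using \<delta>(2) s(1) t ne by force
      then have "m \<le> norm (\<gamma> s - \<gamma> t)" using m(2)[of "(s,t)"] s(1) t by (simp add: K_def)
      also have "\<dots> = \<bar>h\<bar> * norm (Z t)" using s(2) by (simp add: norm_mult)
      also have "\<dots> \<le> \<bar>h\<bar> * B" using B(2)[OF t] by (intro mult_left_mono) auto
      also have "\<dots> < m" using h(2) B(1) by (simp add: pos_less_divide_eq)
      finally show False by simp
    qed
  qed
qed

text \<open>
  A point of the region close to \<open>\<gamma> (1/2)\<close> and the point of the curve nearest to it. The choice of the
  former keeps the touching point away from \<open>\<gamma> 0\<close>, where the curve need not be differentiable.
\<close>

lemma inside_touching_ball:
  fixes \<gamma> :: "real \<Rightarrow> complex"
  assumes simple: "simple_path \<gamma>" "pathfinish \<gamma> = pathstart \<gamma>"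
  obtains y t where "0 < t" "t < 1" "0 < dist y (\<gamma> t)" "ball y (dist y (\<gamma> t)) \<subseteq> inside (path_image \<gamma>)"
    "\<And>s. s \<in> {0..1} \<Longrightarrow> dist y (\<gamma> t) \<le> dist y (\<gamma> s)"
proof -
  let ?I = "inside (path_image \<gamma>)"
  have \<gamma>01: "\<gamma> 1 = \<gamma> 0" using simple(2) by (simp add: pathfinish_def pathstart_def)
  have J: "frontier ?I = path_image \<gamma>" using Jordan_inside_outside[OF simple] by blast
  define \<eta> where "\<eta> = dist (\<gamma> (1/2)) (\<gamma> 0)"
  have "u = v \<or> u = 0 \<and> v = 1 \<or> u = 1 \<and> v = 0"
    if "u \<in> {0..1}" "v \<in> {0..1}" "\<gamma> u = \<gamma> v" for u v
    using simple(1) that unfolding simple_path_def loop_free_def by blast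
  from this[of "1/2" 0] have "\<gamma> (1/2) \<noteq> \<gamma> 0" by auto
  then have \<eta>: "0 < \<eta>" by (simp add: \<eta>_def)
  have "\<gamma> (1/2) \<in> closure ?I"
  proof -
    have "\<gamma> (1/2) \<in> path_image \<gamma>" unfolding path_image_def by (rule imageI) simp
    then show ?thesis using J by (auto simp: frontier_def)
  qed
  then obtain y where y: "y \<in> ?I" "dist y (\<gamma> (1/2)) < \<eta> / 2"
    using \<eta> unfolding closure_approachable by (metis half_gt_zero)
  have "continuous_on {0..1} (\<lambda>s. dist y (\<gamma> s))"
    using simple(1) by (intro continuous_intros) (simp add: simple_path_def path_def)
  then obtain t where t: "t \<in> {0..1}" "\<And>s. s \<in> {0..1} \<Longrightarrow> dist y (\<gamma> t) \<le> dist y (\<gamma> s)"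
    using continuous_attains_inf[of "{0..1::real}" "\<lambda>s. dist y (\<gamma> s)"] by auto
  have "dist (\<gamma> (1/2)) (\<gamma> t) < \<eta>"
    using t(2)[of "1/2"] y(2) dist_triangle[of "\<gamma> (1/2)" "\<gamma> t" y] by (simp add: dist_commute)
  then have "\<gamma> t \<noteq> \<gamma> 0" unfolding \<eta>_def by auto
  then have "t \<noteq> 0" "t \<noteq> 1" using \<gamma>01 by auto
  moreover have pos: "0 < dist y (\<gamma> t)"
  proof -
    have "\<gamma> t \<in> path_image \<gamma>" using t(1) by (auto simp: path_image_def)
    then have "y \<noteq> \<gamma> t" using y(1) inside_no_overlap[of "path_image \<gamma>"] by blast
    then show ?thesis by simp
  qed
  moreover have "ball y (dist y (\<gamma> t)) \<subseteq> ?I"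
  proof (rule ccontr)
    assume "\<not> ?thesis"
    moreover have "y \<in> ball y (dist y (\<gamma> t)) \<inter> ?I" using pos y(1) by simp
    ultimately have "ball y (dist y (\<gamma> t)) \<inter> frontier ?I \<noteq> {}"
      using connected_Int_frontier[OF connected_ball[of y "dist y (\<gamma> t)"], of ?I] by blast
    then obtain w where w: "w \<in> ball y (dist y (\<gamma> t))" "w \<in> path_image \<gamma>"
      unfolding J by (metis IntE ex_in_conv)
    then obtain s where s: "s \<in> {0..1}" "w = \<gamma> s"
      unfolding path_image_def by (metis imageE)
    then show False using t(2)[OF s(1)] w(1) by simp
  qed
  ultimately show thesis
    using that[of t y] t by auto
qed

text \<open>
  In the plane \<open>d\<close> is a multiple of \<open>\<i>v\<close>, so that its inner product with \<open>\<i>Z\<close> is a nonzero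
  multiple of that of \<open>v\<close> with \<open>Z\<close>.
\<close>

lemma inner_rotated_neq_0:
  fixes d v Z :: complex
  assumes "d \<noteq> 0" "d \<bullet> v = 0" "v \<bullet> Z \<noteq> 0"
  shows "d \<bullet> (\<i> * Z) \<noteq> 0"
proof
  assume "d \<bullet> (\<i> * Z) = 0"
  then have a: "Im d * Re Z = Re d * Im Z" by (simp add: inner_complex_def)
  have b: "Re d * Re v + Im d * Im v = 0" using assms(2) by (simp add: inner_complex_def)
  have "Re d * (v \<bullet> Z) = Re Z * (Re d * Re v + Im d * Im v)"
    using a by (simp add: inner_complex_def algebra_simps)
  moreover have "Im d * (v \<bullet> Z) = Im Z * (Re d * Re v + Im d * Im v)"
    using a by (simp add: inner_complex_def algebra_simps)
  ultimately have "Re d = 0" "Im d = 0" using b assms(3) by auto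
  with assms(1) show False by (simp add: complex_eq_iff)
qed

text \<open>
  For a small \<open>h\<close> of either sign the pushed-off curve avoids \<open>\<gamma>\<close>, so that it lies entirely on one side. At the
  point where a ball inside the region touches \<open>\<gamma>\<close> from within, the radius is normal to \<open>\<gamma>\<close>, while \<open>\<i>Z\<close> is not
  tangent to \<open>\<gamma>\<close>; with the right sign of \<open>h\<close> the pushed-off point enters the ball.
\<close>

lemma inside_push_off:
  fixes \<gamma> \<gamma>' Z :: "real \<Rightarrow> complex"
  assumes simple: "simple_path \<gamma>" "pathfinish \<gamma> = pathstart \<gamma>"
    and d: "\<And>u. u \<in> {0..1} \<Longrightarrow> (\<gamma> has_vector_derivative \<gamma>' u) (at u within {0..1})"
    and c: "continuous_on {0..1} \<gamma>'" "continuous_on {0..1} Z" and Z01: "Z 1 = Z 0"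
    and pos: "\<And>t. t \<in> {0..1} \<Longrightarrow> 0 < \<gamma>' t \<bullet> Z t"
  obtains \<kappa> where "\<kappa> \<noteq> 0" "path_image (\<lambda>t. \<gamma> t + \<kappa> * Z t) \<subseteq> inside (path_image \<gamma>)"
proof -
  let ?I = "inside (path_image \<gamma>)"
  obtain \<epsilon> where \<epsilon>: "0 < \<epsilon>" "\<And>t h. t \<in> {0..1} \<Longrightarrow> h \<noteq> 0 \<Longrightarrow> \<bar>h\<bar> < \<epsilon> \<Longrightarrow>
      \<gamma> t + of_real h * (\<i> * Z t) \<notin> path_image \<gamma>"
    using push_off_avoids_curve[OF simple d c Z01 pos] by metis
  obtain y t where t: "0 < t" "t < 1" and y: "0 < dist y (\<gamma> t)" "ball y (dist y (\<gamma> t)) \<subseteq> ?I"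
    "\<And>s. s \<in> {0..1} \<Longrightarrow> dist y (\<gamma> t) \<le> dist y (\<gamma> s)"
    using inside_touching_ball[OF simple] by metis
  have dt: "(\<gamma> has_vector_derivative \<gamma>' t) (at t)"
    using d[of t] t at_within_interior[of t "{0..1}"] by simp
  let ?d = "y - \<gamma> t"
  have "?d \<bullet> \<gamma>' t = 0"
  proof -
    have "((\<lambda>s. (\<gamma> s - y) \<bullet> (\<gamma> s - y)) has_derivative
        (\<lambda>h. (\<gamma> t - y) \<bullet> (h *\<^sub>R \<gamma>' t) + (h *\<^sub>R \<gamma>' t) \<bullet> (\<gamma> t - y))) (at t)"
      using dt unfolding has_vector_derivative_def by (auto intro!: derivative_eq_intros)
    then have "(\<lambda>h. (\<gamma> t - y) \<bullet> (h *\<^sub>R \<gamma>' t) + (h *\<^sub>R \<gamma>' t) \<bullet> (\<gamma> t - y)) = (\<lambda>h. 0)"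
    proof (rule differential_zero_maxmin[rotated 2])
      show "t \<in> {0<..<1}" "open {0<..<1::real}" using t by auto
      have "(\<gamma> t - y) \<bullet> (\<gamma> t - y) \<le> (\<gamma> s - y) \<bullet> (\<gamma> s - y)" if "s \<in> {0<..<1}" for s
      proof -
        have "norm (\<gamma> t - y) \<le> norm (\<gamma> s - y)"
          using y(3)[of s] that by (simp add: dist_norm norm_minus_commute)
        then show ?thesis by (simp add: dot_square_norm power_mono)
      qed
      then show "(\<forall>s\<in>{0<..<1}. (\<gamma> s - y) \<bullet> (\<gamma> s - y) \<le> (\<gamma> t - y) \<bullet> (\<gamma> t - y)) \<or>
          (\<forall>s\<in>{0<..<1}. (\<gamma> t - y) \<bullet> (\<gamma> t - y) \<le> (\<gamma> s - y) \<bullet> (\<gamma> s - y))" by blast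
    qed
    then have "(\<gamma> t - y) \<bullet> (1 *\<^sub>R \<gamma>' t) + (1 *\<^sub>R \<gamma>' t) \<bullet> (\<gamma> t - y) = 0"
      by (rule fun_cong)
    then show ?thesis by (simp add: inner_diff_left inner_diff_right inner_commute)
  qed
  moreover have "\<gamma>' t \<bullet> Z t > 0" using pos t by simp
  ultimately have ne: "?d \<bullet> (\<i> * Z t) \<noteq> 0"
    using y(1) by (intro inner_rotated_neq_0[of _ "\<gamma>' t"]) auto
  define A where "A = ?d \<bullet> (\<i> * Z t)"
  have Zt: "0 < (norm (Z t))\<^sup>2" using ne by auto
  have A: "A \<noteq> 0" using ne by (simp add: A_def)
  \<comment> \<open>The second bound makes the first-order gain towards \<open>y\<close> exceed the second-order loss.\<close>
  define h0 where "h0 = min (\<epsilon> / 2) (\<bar>A\<bar> / (norm (Z t))\<^sup>2)"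
  have h0: "0 < h0" "h0 < \<epsilon>" "h0 * (norm (Z t))\<^sup>2 \<le> \<bar>A\<bar>"
    using \<epsilon>(1) A Zt by (auto simp: h0_def min_def field_simps)
  define h where "h = sgn A * h0"
  have h: "h \<noteq> 0" "\<bar>h\<bar> < \<epsilon>" "h * A = h0 * \<bar>A\<bar>" "h\<^sup>2 = h0\<^sup>2"
    using h0 A by (auto simp: h_def sgn_if abs_mult)
  define p where "p = (\<lambda>t. \<gamma> t + of_real h * (\<i> * Z t))"
  have "(dist y (p t))\<^sup>2 < (dist y (\<gamma> t))\<^sup>2"
  proof -
    have "y - p t = ?d - h *\<^sub>R (\<i> * Z t)" by (simp add: p_def scaleR_conv_of_real)
    then have "(dist y (p t))\<^sup>2 = (norm (?d - h *\<^sub>R (\<i> * Z t)))\<^sup>2"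
      by (simp only: dist_norm)
    also have "\<dots> = (norm ?d)\<^sup>2 - 2 * (h * A) + h\<^sup>2 * (norm (Z t))\<^sup>2"
      unfolding A_def power2_norm_eq_inner
      by (simp add: inner_diff_left inner_diff_right inner_commute power2_eq_square inner_complex_def algebra_simps)
    also have "\<dots> = (norm ?d)\<^sup>2 - h0 * (2 * \<bar>A\<bar> - h0 * (norm (Z t))\<^sup>2)"
      unfolding h by (simp add: power2_eq_square algebra_simps)
    also have "\<dots> < (norm ?d)\<^sup>2"
      using h0 A by simp
    finally show ?thesis by (simp add: dist_norm)
  qed
  then have "p t \<in> ball y (dist y (\<gamma> t))"
    using power2_less_imp_less by (metis mem_ball zero_le_dist)
  then have in1: "p t \<in> path_image p \<inter> ?I" using t y(2) by (auto simp: path_image_def)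
  have "path p"
    using c(2) simple(1) unfolding p_def path_def by (auto simp: simple_path_def path_def intro!: continuous_intros)
  then have conn: "connected (path_image p)" by (rule connected_path_image)
  have "path_image p \<inter> path_image \<gamma> = {}"
    using \<epsilon>(2) h(1,2) unfolding p_def by (force simp: path_image_def)
  then have "path_image p \<inter> frontier ?I = {}"
    using Jordan_inside_outside[OF simple] by auto
  then have "path_image p \<subseteq> ?I"
    using connected_Int_frontier[OF conn, of ?I] in1 by blast
  then show thesis
    using that[of "of_real h * \<i>"] h(1) by (simp add: p_def mult.assoc)
qed

text \<open>
  The loop \<open>\<gamma> + k Z\<close> inside the region contracts to the point \<open>a\<close> within the region, that is, without meeting
  \<open>\<gamma>\<close>. Subtracting \<open>\<gamma>\<close> turns this into a deformation of \<open>k Z\<close> into \<open>a - \<gamma>\<close> in the punctured plane.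
\<close>

theorem winding_number_nowhere_normal_field:
  fixes \<gamma> \<gamma>' Z :: "real \<Rightarrow> complex"
  assumes simple: "simple_path \<gamma>" "pathfinish \<gamma> = pathstart \<gamma>"
    and d: "\<And>u. u \<in> {0..1} \<Longrightarrow> (\<gamma> has_vector_derivative \<gamma>' u) (at u within {0..1})"
    and c: "continuous_on {0..1} \<gamma>'" "continuous_on {0..1} Z" and Z01: "Z 1 = Z 0"
    and tr: "\<And>t. t \<in> {0..1} \<Longrightarrow> \<gamma>' t \<bullet> Z t \<noteq> 0" and a: "a \<in> inside (path_image \<gamma>)"
  shows "winding_number Z 0 = winding_number \<gamma> a"
proof -
  let ?I = "inside (path_image \<gamma>)"
  have cont: "continuous_on {0..1} \<gamma>" and \<gamma>01: "\<gamma> 1 = \<gamma> 0"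
    using simple by (auto simp: simple_path_def path_def pathfinish_def pathstart_def)
  define \<sigma> where "\<sigma> = sgn (\<gamma>' 0 \<bullet> Z 0)"
  define N where "N = (\<lambda>t. of_real \<sigma> * Z t)"
  have \<sigma>0: "\<sigma> \<noteq> 0" using tr[of 0] by (simp add: \<sigma>_def sgn_eq_0_iff)
  have posN: "0 < \<gamma>' t \<bullet> N t" if "t \<in> {0..1}" for t
  proof -
    have "0 < (\<gamma>' 0 \<bullet> Z 0) * (\<gamma>' t \<bullet> Z t)"
      by (rule connected_nonvanishing_same_sign[of "{0..1}"]) (use tr c that in \<open>auto intro!: continuous_intros\<close>)
    then have "0 < \<sigma> * (\<gamma>' t \<bullet> Z t)"
      by (auto simp: \<sigma>_def sgn_if zero_less_mult_iff)
    also have "\<sigma> * (\<gamma>' t \<bullet> Z t) = \<gamma>' t \<bullet> N t"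
      by (simp add: N_def inner_complex_def algebra_simps)
    finally show ?thesis .
  qed
  have N: "continuous_on {0..1} N" "N 1 = N 0"
    using c(2) Z01 by (auto simp: N_def intro!: continuous_intros)
  obtain \<kappa> where \<kappa>: "\<kappa> \<noteq> 0" "path_image (\<lambda>t. \<gamma> t + \<kappa> * N t) \<subseteq> ?I"
    by (rule inside_push_off[OF simple d c(1) N posN])
  define k where "k = \<kappa> * of_real \<sigma>"
  have k: "k \<noteq> 0" "path_image (\<lambda>t. \<gamma> t + k * Z t) \<subseteq> ?I"
    using \<kappa> \<sigma>0 by (auto simp: k_def N_def mult.assoc)
  let ?p = "\<lambda>t. \<gamma> t + k * Z t"
  have "path ?p" using cont c(2) unfolding path_def by (intro continuous_intros)
  then have "homotopic_loops ?I ?p (linepath a a)"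
    using simply_connected_inside_simple_path[OF simple(1)] k(2) a Z01 \<gamma>01
    unfolding simply_connected_eq_contractible_loop_any by (auto simp: pathfinish_def pathstart_def)
  then obtain H :: "real \<times> real \<Rightarrow> complex" where H: "continuous_on ({0..1} \<times> {0..1}) H" "H \<in> {0..1} \<times> {0..1} \<rightarrow> ?I"
    "\<forall>t\<in>{0..1}. H (0, t) = ?p t" "\<forall>t\<in>{0..1}. H (1, t) = linepath a a t"
    "\<forall>s\<in>{0..1}. pathfinish (H \<circ> Pair s) = pathstart (H \<circ> Pair s)"
    unfolding homotopic_loops by blast
  have "homotopic_loops (- {0}) (\<lambda>t. k * Z t) (\<lambda>t. a - \<gamma> t)"
    unfolding homotopic_loops
  proof (intro exI conjI ballI)
    let ?H = "\<lambda>x. H x - \<gamma> (snd x)"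
    show "continuous_on ({0..1} \<times> {0..1}) ?H"
      by (intro continuous_intros H(1) continuous_on_compose2[OF cont]) auto
    show "?H \<in> {0..1} \<times> {0..1} \<rightarrow> - {0}"
    proof
      fix x :: "real \<times> real" assume x: "x \<in> {0..1} \<times> {0..1}"
      then have "H x \<in> ?I" "\<gamma> (snd x) \<in> path_image \<gamma>" using H(2) by (auto simp: path_image_def)
      then have "H x \<noteq> \<gamma> (snd x)" using inside_no_overlap[of "path_image \<gamma>"] by (metis disjoint_iff)
      then show "?H x \<in> - {0}" by simp
    qed
    show "?H (0, t) = k * Z t" "?H (1, t) = a - \<gamma> t" if "t \<in> {0..1}" for t
      using H(3,4) that by (auto simp: linepath_def algebra_simps)
    show "pathfinish (?H \<circ> Pair s) = pathstart (?H \<circ> Pair s)" if "s \<in> {0..1}" for s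
      using H(5) that \<gamma>01 by (simp add: pathfinish_def pathstart_def)
  qed
  then have "winding_number (\<lambda>t. k * Z t) 0 = winding_number (\<lambda>t. a - \<gamma> t) 0"
    by (rule winding_number_homotopic_loops)
  also have "\<dots> = winding_number (\<lambda>t. (-1) * (\<gamma> t - a)) 0" by simp
  also have "\<dots> = winding_number (\<lambda>t. \<gamma> t - a) 0"
  proof (rule winding_number_const_times)
    show "path (\<lambda>t. \<gamma> t - a)" using cont unfolding path_def by (intro continuous_intros)
    show "0 \<notin> path_image (\<lambda>t. \<gamma> t - a)"
    proof -
      have "a \<notin> path_image \<gamma>"
        using a inside_no_overlap[of "path_image \<gamma>"] by (metis disjoint_iff)
      then show ?thesis by (auto simp: path_image_def)
    qed
  qed simp
  also have "\<dots> = winding_number \<gamma> a" by (metis winding_number_offset)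
  also have "winding_number (\<lambda>t. k * Z t) 0 = winding_number Z 0"
  proof (rule winding_number_const_times)
    show "path Z" using c(2) by (simp add: path_def)
    show "0 \<notin> path_image Z" using tr by (force simp: path_image_def)
  qed (rule k(1))
  finally show ?thesis .
qed

section \<open>The degree in the presence of a guiding function\<close>

theorem mainTheorem12:
  fixes T \<theta>\<^sub>1 \<theta>\<^sub>2 :: real
    and x xdot z :: "real \<Rightarrow> real^2"
    and U :: "(real^2) set"
    and F :: "real^2 \<Rightarrow> real^2"
  assumes "T > 0"
    and x_C1: "\<And>\<theta>. \<theta> \<in> {0..T} \<Longrightarrow> (x has_vector_derivative xdot \<theta>) (at \<theta> within {0..T})"
      "continuous_on {0..T} xdot"
    and x_Jordan: "x 0 = x T" "inj_on x {0..<T}"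
    and U: "U = inside (x ` {0..T})"
    and F: "continuous_on UNIV F" "\<And>\<xi>. \<xi> \<in> frontier U \<Longrightarrow> F \<xi> \<noteq> 0"
    and z: "continuous_on {0..T} z" "z 0 = z T"
    and transversal: "\<And>\<theta>. \<theta> \<in> {0..T} \<Longrightarrow> z \<theta> \<bullet> xdot \<theta> \<noteq> 0"
    and zeros: "\<theta>\<^sub>1 \<noteq> \<theta>\<^sub>2" "{\<theta> \<in> {0..<T}. F (x \<theta>) \<bullet> z \<theta> = 0} = {\<theta>\<^sub>1, \<theta>\<^sub>2}"
    and monotone: "strictly_monotone_at (\<lambda>\<theta>. F (x \<theta>) \<bullet> z \<theta>) {0..T} \<theta>\<^sub>1"
      "strictly_monotone_at (\<lambda>\<theta>. F (x \<theta>) \<bullet> z \<theta>) {0..T} \<theta>\<^sub>2"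
    and signs: "sgn (F (x \<theta>\<^sub>1) \<bullet> vector [z \<theta>\<^sub>1 $ 2, - (z \<theta>\<^sub>1 $ 1)])
              = - sgn (F (x \<theta>\<^sub>2) \<bullet> vector [z \<theta>\<^sub>2 $ 2, - (z \<theta>\<^sub>2 $ 1)])"
  shows "brouwer_degree F U = 0 \<or> brouwer_degree F U = 2"
proof -
  define \<gamma> \<gamma>' Z where "\<gamma> = (\<lambda>u. complex_of_vec (x (T * u)))"
    and "\<gamma>' = (\<lambda>u. T *\<^sub>R complex_of_vec (xdot (T * u)))" and "Z = (\<lambda>u. complex_of_vec (z (T * u)))"
  have scale: "(\<lambda>u. T * u) ` {0..1} = {0..T}" "\<And>u. u \<in> {0..1} \<Longrightarrow> T * u \<in> {0..T}"
    using \<open>T > 0\<close> by (auto simp: image_mult_atLeastAtMost mult_le_cancel_left2)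
  have deriv: "(\<gamma> has_vector_derivative \<gamma>' u) (at u within {0..1})" if u: "u \<in> {0..1}" for u
  proof -
    have "((\<lambda>u. T * u) has_vector_derivative T) (at u within {0..1})"
      by (auto intro!: derivative_eq_intros)
    moreover have "(x has_vector_derivative xdot (T * u)) (at (T * u) within (\<lambda>u. T * u) ` {0..1})"
      using x_C1(1) scale u by simp
    ultimately have "((x \<circ> (\<lambda>u. T * u)) has_vector_derivative T *\<^sub>R xdot (T * u)) (at u within {0..1})"
      by (rule vector_diff_chain_within)
    then have "((\<lambda>u. complex_of_vec ((x \<circ> (\<lambda>u. T * u)) u)) has_vector_derivative
        complex_of_vec (T *\<^sub>R xdot (T * u))) (at u within {0..1})"
      by (rule bounded_linear.has_vector_derivative[OF bounded_linear_complex_of_vec])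
    then show ?thesis by (simp add: \<gamma>_def \<gamma>'_def)
  qed
  have cont_x: "continuous_on {0..T} x"
    using x_C1(1) has_vector_derivative_continuous continuous_on_eq_continuous_within by blast
  have comp: "continuous_on {0..1} (\<lambda>u. f (T * u))" if "continuous_on {0..T} f"
    for f :: "real \<Rightarrow> real^2"
    by (rule continuous_on_compose2[OF that]) (use scale in \<open>auto intro!: continuous_intros\<close>)
  have cont: "continuous_on {0..1} \<gamma>" "continuous_on {0..1} \<gamma>'" "continuous_on {0..1} Z"
    unfolding \<gamma>_def \<gamma>'_def Z_def using comp cont_x x_C1(2) z(1) by (auto intro!: continuous_intros)
  have loops: "pathfinish \<gamma> = pathstart \<gamma>" "Z 1 = Z 0"
    using x_Jordan(1) z(2) by (auto simp: \<gamma>_def Z_def pathfinish_def pathstart_def)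
  have simple: "simple_path \<gamma>"
    unfolding simple_path_def loop_free_def
  proof (intro conjI ballI impI)
    show "path \<gamma>" using cont(1) by (simp add: path_def)
    fix u v :: real assume uv: "u \<in> {0..1}" "v \<in> {0..1}" "\<gamma> u = \<gamma> v"
    then have eq: "x (T * u) = x (T * v)"
      unfolding \<gamma>_def by (metis vec_of_complex_inverse(2))
    have inj: "a = b" if "a \<in> {0..<1}" "b \<in> {0..<1}" "x (T * a) = x (T * b)" for a b
      using inj_onD[OF x_Jordan(2) that(3)] that(1,2) \<open>T > 0\<close> by auto
    show "u = v \<or> u = 0 \<and> v = 1 \<or> u = 1 \<and> v = 0"
    proof (cases "u = 1"; cases "v = 1")
      assume *: "u = 1" "v \<noteq> 1"
      have "0 = v" by (rule inj) (use * eq uv(2) x_Jordan(1) in auto)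
      with * show ?thesis by simp
    next
      assume *: "u \<noteq> 1" "v = 1"
      have "u = 0" by (rule inj) (use * eq uv(1) x_Jordan(1) in auto)
      with * show ?thesis by simp
    next
      assume *: "u \<noteq> 1" "v \<noteq> 1"
      have "u = v" by (rule inj) (use * eq uv(1,2) in auto)
      then show ?thesis by simp
    qed simp
  qed
  have pim: "path_image \<gamma> = complex_of_vec ` x ` {0..T}"
    unfolding path_image_def \<gamma>_def scale(1)[symmetric] by (simp add: image_image)
  have U': "U = vec_of_complex ` inside (path_image \<gamma>)"
    unfolding pim U
    by (subst inside_homeomorphic_image[OF bounded_linear_complex_of_vec bounded_linear_vec_of_complex])
       (simp_all add: image_image)
  obtain b where b: "b \<in> inside (path_image \<gamma>)"
    using Jordan_inside_outside[OF simple loops(1)] by blast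
  define W where "W = (\<lambda>t. complex_of_vec (F (vec_of_complex (\<gamma> t))))"
  have W: "W u = complex_of_vec (F (x (T * u)))" for u by (simp add: W_def \<gamma>_def)
  have deg: "of_int (brouwer_degree F U) = winding_number W 0 * winding_number \<gamma> b"
    unfolding W_def
    by (rule brouwer_degree_eq_winding_number[OF simple loops(1) U' b _ F(2)])
       (auto intro: continuous_on_subset[OF F(1)])
  have Zb: "winding_number Z 0 = winding_number \<gamma> b"
  proof (rule winding_number_nowhere_normal_field[OF simple loops(1) deriv cont(2,3) loops(2) _ b])
    show "\<gamma>' t \<bullet> Z t \<noteq> 0" if "t \<in> {0..1}" for t
    proof -
      have "\<gamma>' t \<bullet> Z t = T * (z (T * t) \<bullet> xdot (T * t))"
        by (simp add: \<gamma>'_def Z_def complex_of_vec_def inner_complex_def inner_vec_def sum_2 algebra_simps)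
      then show ?thesis using transversal scale(2)[OF that] \<open>T > 0\<close> by simp
    qed
  qed
  have frU: "x \<theta> \<in> frontier U" if "\<theta> \<in> {0..T}" for \<theta>
  proof -
    have "frontier U = x ` {0..T}"
      unfolding Jordan_region_vec_of_complex(2)[OF simple loops(1) U'] pim by (simp add: image_image)
    then show ?thesis using that by blast
  qed
  have nz: "W u \<noteq> 0" "Z u \<noteq> 0" if "u \<in> {0..1}" for u
    using F(2)[OF frU] transversal scale(2)[OF that] by (force simp: W Z_def)+
  have pW: "path W" "0 \<notin> path_image W" and pZ: "path Z" "0 \<notin> path_image Z"
    using cont(3) nz unfolding path_def path_image_def W_def
    by (auto intro!: continuous_intros cont(1) continuous_on_compose2[OF F(1)])
  have loopW: "pathfinish W = pathstart W" and loopZ: "pathfinish Z = pathstart Z"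
    using loops by (auto simp: W_def pathfinish_def pathstart_def)
  \<comment> \<open>The real and imaginary parts of \<open>q\<close> are, up to sign, the inner products in the second and third hypothesis.\<close>
  define q where "q = (\<lambda>u. W u * cnj (Z u))"
  have pcZ: "path (\<lambda>u. cnj (Z u))" "0 \<notin> path_image (\<lambda>u. cnj (Z u))"
    using pZ by (auto simp: path_def path_image_def intro!: continuous_intros)
  have wq: "winding_number q 0 = winding_number W 0 - winding_number \<gamma> b"
    unfolding q_def using winding_number_times[OF pW pcZ] winding_number_cnj_loop[OF pZ loopZ] Zb by simp
  define f where "f = (\<lambda>\<theta>. F (x \<theta>) \<bullet> z \<theta>)"
  have Re_q: "Re (q u) = f (T * u)" for u
    unfolding q_def W Z_def f_def by (rule Re_times_cnj_complex_of_vec)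
  have Im_q: "Im (q u) = - (F (x (T * u)) \<bullet> vector [z (T * u) $ 2, - (z (T * u) $ 1)])" for u
    by (simp add: q_def W Z_def complex_of_vec_def inner_vec_def sum_2)
  define \<theta>a \<theta>b where "\<theta>a = min \<theta>\<^sub>1 \<theta>\<^sub>2" and "\<theta>b = max \<theta>\<^sub>1 \<theta>\<^sub>2"
  have ab: "\<theta>a < \<theta>b" "\<theta>a = \<theta>\<^sub>1 \<and> \<theta>b = \<theta>\<^sub>2 \<or> \<theta>a = \<theta>\<^sub>2 \<and> \<theta>b = \<theta>\<^sub>1"
    using zeros(1) by (auto simp: \<theta>a_def \<theta>b_def)
  have zab: "{\<theta> \<in> {0..<T}. f \<theta> = 0} = {\<theta>a, \<theta>b}"
    using zeros(2) ab(2) by (auto simp: f_def)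
  have rab: "0 \<le> \<theta>a" "\<theta>b < T" using zab ab(1) by auto
  have "continuous_on {0..T} f"
    unfolding f_def by (intro continuous_intros z(1) continuous_on_compose2[OF F(1) cont_x]) auto
  moreover have "f 0 = f T" using x_Jordan(1) z(2) by (simp add: f_def)
  moreover have "strictly_monotone_at f {0..T} \<theta>b"
    using monotone ab(2) by (auto simp: f_def)
  ultimately obtain \<sigma> where \<sigma>: "\<sigma> = 1 \<or> \<sigma> = -1" "\<And>t. t \<in> {\<theta>a..\<theta>b} \<Longrightarrow> 0 \<le> \<sigma> * f t"
    "\<And>t. t \<in> {0..\<theta>a} \<union> {\<theta>b..T} \<Longrightarrow> \<sigma> * f t \<le> 0"
    using sign_pattern_two_zeros[OF _ _ ab(1) zab] by metis
  have "winding_number q 0 = 1 \<or> winding_number q 0 = -1"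
  proof (rule winding_number_two_imaginary_axis_crossings)
    show "path q" using pW(1) pZ(1) unfolding q_def path_def by (intro continuous_intros)
    show "pathfinish q = pathstart q"
      using loopW loopZ by (simp add: q_def pathfinish_def pathstart_def)
    show "0 \<notin> path_image q" using nz by (auto simp: q_def path_image_def)
    show "0 \<le> \<theta>a / T" "\<theta>a / T \<le> \<theta>b / T" "\<theta>b / T \<le> 1"
      using rab ab(1) \<open>T > 0\<close> by (auto simp: field_simps)
    show "\<sigma> = 1 \<or> \<sigma> = -1" by (rule \<sigma>(1))
    show "0 \<le> \<sigma> * Re (q t)" if "t \<in> {\<theta>a / T..\<theta>b / T}" for t
      unfolding Re_q using \<open>T > 0\<close> that by (intro \<sigma>(2)) (auto simp: field_simps)
    show "\<sigma> * Re (q t) \<le> 0" if "t \<in> {0..\<theta>a / T} \<union> {\<theta>b / T..1}" for t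
      unfolding Re_q using \<open>T > 0\<close> that by (intro \<sigma>(3)) (auto simp: field_simps)
    show "sgn (Im (q (\<theta>a / T))) = - sgn (Im (q (\<theta>b / T)))"
      unfolding Im_q using signs ab(2) \<open>T > 0\<close> by (auto simp: sgn_minus)
  qed
  moreover have W0: "winding_number W 0 = winding_number q 0 + winding_number \<gamma> b"
    using wq by simp
  moreover have W0: "winding_number W 0 = winding_number q 0 + winding_number \<gamma> b"
    using wq by simp
  moreover have "winding_number \<gamma> b = 1 \<or> winding_number \<gamma> b = -1"
    using simple_closed_path_winding_number_inside[OF simple] b by metis
  ultimately have "complex_of_int (brouwer_degree F U) = of_int 0 \<or> complex_of_int (brouwer_degree F U) = of_int 2"
    unfolding deg using W0 by auto
  then show ?thesis by (simp only: of_int_eq_iff)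
qed

end
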